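(* Let $\alpha,\beta,\sigma$, $\lambda=\alpha+\beta$, $\eta=\alpha\beta$, $\mu_{\alpha,\beta,\sigma}$, $X_{\alpha,\beta}$, $\mathbb F_{\eta,\sigma}(\mathbb C)$ and the unitary operator $\mathbb S$ be as in the context, and let $$\rho=\mathbb U\mathbb V=Z+\lambda ZD+\frac\sigma\alpha+\sigma D+\eta ZD^2,$$ acting in $\mathcal P(\mathbb C)$. The operator $\rho$ is essentially self-adjoint in $\mathbb F_{\eta,\sigma}(\mathbb C)$; keep the notation $\rho$ for its closure. If $\alpha\ge\beta>0$, then $\mathbb S^{-1}\rho\,\mathbb S$ is the operator of multiplication by the variable $x$ in $L^2(X_{\alpha,\beta},\mu_{\alpha,\beta,\sigma})$. If $\Re(\alpha)\ge0$, $\Im(\alpha)>0$ and $\beta=\overline\alpha$, then $\mathbb S^{-1}(\rho-\frac\sigma\alpha)\mathbb S$ is the operator of multiplication by the variable $x$ in $L^2(\mathbb R,\mu_{\alpha,\beta,\sigma})$.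
   Context: $\mathbb N_0=\{0,1,2,\dots\}$; $(z\mid h)_0=1$, $(z\mid h)_n=z(z-h)\cdots(z-(n-1)h)$; $(z)^{(n)}=(z\mid-1)_n$. $\mathcal P(\mathbb C)$ is the space of complex polynomials; $Z$ is multiplication by $z$ and $D=d/dz$. The operators $\mathbb U=Z+\beta ZD+\frac\sigma\alpha$ and $\mathbb V=\alpha D+1$ act in $\mathcal P(\mathbb C)$. Parameters: $\sigma>0$, and $\alpha,\beta\in\mathbb C$ satisfy one of: $\alpha=\beta>0$; $\alpha>\beta>0$; $\Re(\alpha)\ge0$, $\Im(\alpha)>0$, $\beta=\overline\alpha$. Put $\lambda=\alpha+\beta$, $\eta=\alpha\beta>0$, $l=\sigma/\alpha$ in the first two cases, $l=0$ in the third. $(s_n)$ is the monic polynomial sequence with $s_0=1$, $xs_n(x)=s_{n+1}(x)+(\lambda n+l)s_n(x)+(\sigma n+\eta n(n-1))s_{n-1}(x)$, orthogonal with respect to the probability measure $\mu_{\alpha,\beta,\sigma}$ on $X_{\alpha,\beta}$: - $\alpha=\beta>0$: $X_{\alpha,\beta}=(0,\infty)$, $\mu_{\alpha,\alpha,\sigma}(dx)=\frac1{\Gamma(\sigma/\eta)}\alpha^{-\sigma/\eta}x^{-1+\sigma/\eta}e^{-x/\alpha}dx$; - $\alpha>\beta>0$: $X_{\alpha,\beta}=(\alpha-\beta)\mathbb N_0$, $\mu_{\alpha,\beta,\sigma}=(1-\frac\beta\alpha)^{\sigma/\eta}\sum_{n\ge0}(\frac\beta\alpha)^n\frac1{n!}(\frac\sigma\eta)^{(n)}\delta_{(\alpha-\beta)n}$;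 - third case: $X_{\alpha,\beta}=\mathbb R$, $\mu_{\alpha,\beta,\sigma}(dx)=C_{\alpha,\beta,\sigma}\exp\big((\frac\pi2-\operatorname{Arg}(\alpha))x/\Im(\alpha)\big)\big|\Gamma\big(\frac{ix}{2\Im(\alpha)}+\frac{i\sigma\beta}{2\eta\Im(\alpha)}\big)\big|^2dx$, $\operatorname{Arg}(\alpha)\in(0,\pi/2]$, $C_{\alpha,\beta,\sigma}=\frac{(2\cos(\frac\pi2-\operatorname{Arg}(\alpha)))^{\sigma/\eta}}{4\Im(\alpha)\pi\Gamma(\sigma/\eta)}\exp\big(\frac{(\frac\pi2-\operatorname{Arg}(\alpha))\sigma\Re(\alpha)}{\Im(\alpha)\eta}\big)$. $\mathbb F_{\eta,\sigma}(\mathbb C)$ is the Hilbert space of entire functions $\varphi(z)=\sum_nf_nz^n$ with $\|\varphi\|^2=\sum_n|f_n|^2n!\,(\sigma\mid-\eta)_n<\infty$ (the $z^n$ being orthogonal). $\mathbb S:L^2(X_{\alpha,\beta},\mu_{\alpha,\beta,\sigma})\to\mathbb F_{\eta,\sigma}(\mathbb C)$ is the unitary operator with $(\mathbb Ss_n)(z)=z^n$ for all $n\in\mathbb N_0$.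
   Formalization: In the third case (Im α > 0, β the conjugate of α), ρ is not symmetric because ⟨ρ1,1⟩ = σ/α is not real, so essential self-adjointness is stated and proved there for ρ − σ/α; in the first two cases it is for ρ itself. *)

theory Defs
  imports "HOL-Complex_Analysis.Complex_Analysis"
begin

text \<open>A complex inner product space on an explicit carrier; \<open>ip\<close> is linear in its
  first argument. (Explicit carriers are needed because the spaces below depend on real and
  complex parameters.)\<close>

record 'a ip_space =
  points :: "'a set"
  add :: "'a \<Rightarrow> 'a \<Rightarrow> 'a"
  scale :: "complex \<Rightarrow> 'a \<Rightarrow> 'a"
  ip :: "'a \<Rightarrow> 'a \<Rightarrow> complex"

definition ip_dist :: "'a ip_space \<Rightarrow> 'a \<Rightarrow> 'a \<Rightarrow> real" where
  "ip_dist H x y = (let d = add H x (scale H (-1) y) in sqrt (Re (ip H d d)))"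

text \<open>Unbounded operators are represented by their graphs, so that equality of operators
  includes equality of the domains.\<close>

type_synonym 'a op_graph = "('a \<times> 'a) set"

definition densely_defined :: "'a ip_space \<Rightarrow> 'a op_graph \<Rightarrow> bool" where
  "densely_defined H T \<longleftrightarrow>
     T \<subseteq> points H \<times> points H \<and>
     (\<forall>x\<in>points H. \<forall>e>0. \<exists>y\<in>Domain T. ip_dist H x y < e)"

definition op_closure :: "'a ip_space \<Rightarrow> 'a op_graph \<Rightarrow> 'a op_graph" where
  "op_closure H T = {(x, y). x \<in> points H \<and> y \<in> points H \<and>
     (\<exists>u v. (\<forall>n::nat. (u n, v n) \<in> T) \<and>
        (\<lambda>n. ip_dist H (u n) x) \<longlonglongrightarrow> 0 \<and> (\<lambda>n. ip_dist H (v n) y) \<longlonglongrightarrow> 0)}"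

definition adjoint_op :: "'a ip_space \<Rightarrow> 'a op_graph \<Rightarrow> 'a op_graph" where
  "adjoint_op H T = {(x, y). x \<in> points H \<and> y \<in> points H \<and>
     (\<forall>(u, v)\<in>T. ip H v x = ip H u y)}"

definition symmetric_op :: "'a ip_space \<Rightarrow> 'a op_graph \<Rightarrow> bool" where
  "symmetric_op H T \<longleftrightarrow> densely_defined H T \<and> T \<subseteq> adjoint_op H T"

definition self_adjoint_op :: "'a ip_space \<Rightarrow> 'a op_graph \<Rightarrow> bool" where
  "self_adjoint_op H T \<longleftrightarrow> densely_defined H T \<and> T = adjoint_op H T"

definition essentially_self_adjoint :: "'a ip_space \<Rightarrow> 'a op_graph \<Rightarrow> bool" where
  "essentially_self_adjoint H T \<longleftrightarrow> symmetric_op H T \<and> self_adjoint_op H (op_closure H T)"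

definition op_minus_scalar :: "'a ip_space \<Rightarrow> 'a op_graph \<Rightarrow> complex \<Rightarrow> 'a op_graph" where
  "op_minus_scalar H T c = {(x, add H y (scale H (- c) x)) | x y. (x, y) \<in> T}"

definition unitary_op :: "'a ip_space \<Rightarrow> 'b ip_space \<Rightarrow> ('a \<Rightarrow> 'b) \<Rightarrow> bool" where
  "unitary_op H K S \<longleftrightarrow> bij_betw S (points H) (points K) \<and>
     (\<forall>x\<in>points H. \<forall>y\<in>points H. S (add H x y) = add K (S x) (S y)) \<and>
     (\<forall>c. \<forall>x\<in>points H. S (scale H c x) = scale K c (S x)) \<and>
     (\<forall>x\<in>points H. \<forall>y\<in>points H. ip K (S x) (S y) = ip H x y)"

text \<open>The operator \<open>S\<inverse> T S\<close> on its natural domain, for an operator \<open>T\<close> in the target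
  space of \<open>S\<close>.\<close>

definition op_conj :: "'a ip_space \<Rightarrow> ('a \<Rightarrow> 'b) \<Rightarrow> 'b op_graph \<Rightarrow> 'a op_graph" where
  "op_conj H S T = {(x, the_inv_into (points H) S w) | x w. x \<in> points H \<and> (S x, w) \<in> T}"

definition square_integrable :: "real measure \<Rightarrow> (real \<Rightarrow> complex) set" where
  "square_integrable M =
     {f \<in> borel_measurable M. integrable M (\<lambda>x. (cmod (f x))\<^sup>2)}"

definition ae_class :: "real measure \<Rightarrow> (real \<Rightarrow> complex) \<Rightarrow> (real \<Rightarrow> complex) set" where
  "ae_class M f = {g \<in> borel_measurable M. AE x in M. g x = f x}"

definition rep :: "(real \<Rightarrow> complex) set \<Rightarrow> real \<Rightarrow> complex" where
  "rep A = (SOME f. f \<in> A)"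

definition L2 :: "real measure \<Rightarrow> (real \<Rightarrow> complex) set ip_space" where
  "L2 M = \<lparr>
     points = ae_class M ` square_integrable M,
     add = (\<lambda>A B. ae_class M (\<lambda>x. rep A x + rep B x)),
     scale = (\<lambda>c A. ae_class M (\<lambda>x. c * rep A x)),
     ip = (\<lambda>A B. \<integral>x. rep A x * cnj (rep B x) \<partial>M) \<rparr>"

text \<open>The domain is the maximal one.\<close>

definition mult_by_var :: "real measure \<Rightarrow> (real \<Rightarrow> complex) set op_graph" where
  "mult_by_var M = {(ae_class M f, ae_class M (\<lambda>x. of_real x * f x)) | f.
     f \<in> square_integrable M \<and> (\<lambda>x. of_real x * f x) \<in> square_integrable M}"

text \<open>\<open>(z | h)\<^sub>n\<close>\<close>

definition gen_ffact :: "real \<Rightarrow> real \<Rightarrow> nat \<Rightarrow> real" where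
  "gen_ffact z h n = (\<Prod>k<n. z - of_nat k * h)"

definition taylor_coeff :: "(complex \<Rightarrow> complex) \<Rightarrow> nat \<Rightarrow> complex" where
  "taylor_coeff \<phi> n = fps_nth (fps_expansion \<phi> 0) n"

definition fock :: "real \<Rightarrow> real \<Rightarrow> (complex \<Rightarrow> complex) ip_space" where
  "fock \<eta> \<sigma> = \<lparr>
     points = {\<phi>. \<phi> holomorphic_on UNIV \<and>
       summable (\<lambda>n. (cmod (taylor_coeff \<phi> n))\<^sup>2 * fact n * gen_ffact \<sigma> (- \<eta>) n)},
     add = (\<lambda>\<phi> \<psi> z. \<phi> z + \<psi> z),
     scale = (\<lambda>c \<phi> z. c * \<phi> z),
     ip = (\<lambda>\<phi> \<psi>. \<Sum>n. taylor_coeff \<phi> n * cnj (taylor_coeff \<psi> n) *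
              of_real (fact n * gen_ffact \<sigma> (- \<eta>) n)) \<rparr>"

definition gamma_case :: "complex \<Rightarrow> complex \<Rightarrow> bool" where
  "gamma_case \<alpha> \<beta> \<longleftrightarrow> Im \<alpha> = 0 \<and> Im \<beta> = 0 \<and> Re \<alpha> = Re \<beta> \<and> Re \<beta> > 0"

definition negbin_case :: "complex \<Rightarrow> complex \<Rightarrow> bool" where
  "negbin_case \<alpha> \<beta> \<longleftrightarrow> Im \<alpha> = 0 \<and> Im \<beta> = 0 \<and> Re \<alpha> > Re \<beta> \<and> Re \<beta> > 0"

definition meixner_case :: "complex \<Rightarrow> complex \<Rightarrow> bool" where
  "meixner_case \<alpha> \<beta> \<longleftrightarrow> Re \<alpha> \<ge> 0 \<and> Im \<alpha> > 0 \<and> \<beta> = cnj \<alpha>"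

text \<open>In all three cases \<open>\<alpha> * \<beta>\<close> is a positive real number, so taking the real part loses
  nothing.\<close>

definition eta :: "complex \<Rightarrow> complex \<Rightarrow> real" where
  "eta \<alpha> \<beta> = Re (\<alpha> * \<beta>)"

definition ell :: "complex \<Rightarrow> complex \<Rightarrow> real \<Rightarrow> complex" where
  "ell \<alpha> \<beta> \<sigma> = (if meixner_case \<alpha> \<beta> then 0 else of_real \<sigma> / \<alpha>)"

definition X_set :: "complex \<Rightarrow> complex \<Rightarrow> real set" where
  "X_set \<alpha> \<beta> =
     (if meixner_case \<alpha> \<beta> then UNIV
      else if gamma_case \<alpha> \<beta> then {0<..}
      else range (\<lambda>n::nat. (Re \<alpha> - Re \<beta>) * real n))"

definition gamma_density :: "complex \<Rightarrow> complex \<Rightarrow> real \<Rightarrow> real \<Rightarrow> real" where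
  "gamma_density \<alpha> \<beta> \<sigma> x =
     1 / Gamma (\<sigma> / eta \<alpha> \<beta>) * Re \<alpha> powr (- \<sigma> / eta \<alpha> \<beta>) *
       x powr (-1 + \<sigma> / eta \<alpha> \<beta>) * exp (- x / Re \<alpha>)"

definition negbin_weight :: "complex \<Rightarrow> complex \<Rightarrow> real \<Rightarrow> nat \<Rightarrow> real" where
  "negbin_weight \<alpha> \<beta> \<sigma> n =
     (1 - Re \<beta> / Re \<alpha>) powr (\<sigma> / eta \<alpha> \<beta>) *
       ((Re \<beta> / Re \<alpha>) ^ n * (1 / fact n) * gen_ffact (\<sigma> / eta \<alpha> \<beta>) (-1) n)"

definition meixner_const :: "complex \<Rightarrow> complex \<Rightarrow> real \<Rightarrow> real" where
  "meixner_const \<alpha> \<beta> \<sigma> =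
     (2 * cos (pi / 2 - Arg \<alpha>)) powr (\<sigma> / eta \<alpha> \<beta>) /
       (4 * Im \<alpha> * pi * Gamma (\<sigma> / eta \<alpha> \<beta>)) *
     exp ((pi / 2 - Arg \<alpha>) * \<sigma> * Re \<alpha> / (Im \<alpha> * eta \<alpha> \<beta>))"

definition meixner_density :: "complex \<Rightarrow> complex \<Rightarrow> real \<Rightarrow> real \<Rightarrow> real" where
  "meixner_density \<alpha> \<beta> \<sigma> x =
     meixner_const \<alpha> \<beta> \<sigma> * exp ((pi / 2 - Arg \<alpha>) * x / Im \<alpha>) *
     (cmod (Gamma (\<i> * of_real x / of_real (2 * Im \<alpha>) +
                   \<i> * of_real \<sigma> * \<beta> / of_real (2 * eta \<alpha> \<beta> * Im \<alpha>))))\<^sup>2"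

text \<open>The underlying set of the measure is \<open>X_set \<alpha> \<beta>\<close>. In the discrete case the measure
  \<open>\<Sum>n. w n \<delta>\<^bsub>(\<alpha> - \<beta>) n\<^esub>\<close> is the image of the measure with weights \<open>w\<close> on \<open>\<nat>\<close>.\<close>

definition mu :: "complex \<Rightarrow> complex \<Rightarrow> real \<Rightarrow> real measure" where
  "mu \<alpha> \<beta> \<sigma> =
     (if meixner_case \<alpha> \<beta> then
        density (restrict_space lborel (X_set \<alpha> \<beta>)) (\<lambda>x. ennreal (meixner_density \<alpha> \<beta> \<sigma> x))
      else if gamma_case \<alpha> \<beta> then
        density (restrict_space lborel (X_set \<alpha> \<beta>)) (\<lambda>x. ennreal (gamma_density \<alpha> \<beta> \<sigma> x))
      else
        distr (density (count_space UNIV) (\<lambda>n. ennreal (negbin_weight \<alpha> \<beta> \<sigma> n)))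
          (restrict_space borel (X_set \<alpha> \<beta>)) (\<lambda>n. (Re \<alpha> - Re \<beta>) * real n))"

text \<open>The recurrence \<open>x s\<^sub>n = s\<^sub>n\<^sub>+\<^sub>1 + (\<lambda> n + l) s\<^sub>n + (\<sigma> n + \<eta> n (n - 1)) s\<^sub>n\<^sub>-\<^sub>1\<close>, solved for
  \<open>s\<^sub>n\<^sub>+\<^sub>1\<close>; for \<open>n = 0\<close> the last coefficient vanishes.\<close>

fun s_poly :: "complex \<Rightarrow> complex \<Rightarrow> real \<Rightarrow> nat \<Rightarrow> complex poly" where
  "s_poly \<alpha> \<beta> \<sigma> 0 = 1"
| "s_poly \<alpha> \<beta> \<sigma> (Suc n) =
     [:0, 1:] * s_poly \<alpha> \<beta> \<sigma> n
     - smult ((\<alpha> + \<beta>) * of_nat n + ell \<alpha> \<beta> \<sigma>) (s_poly \<alpha> \<beta> \<sigma> n)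
     - smult (of_real \<sigma> * of_nat n + of_real (eta \<alpha> \<beta>) * of_nat n * (of_nat n - 1))
         (s_poly \<alpha> \<beta> \<sigma> (n - 1))"

definition intertwines_s_poly ::
  "complex \<Rightarrow> complex \<Rightarrow> real \<Rightarrow> ((real \<Rightarrow> complex) set \<Rightarrow> complex \<Rightarrow> complex) \<Rightarrow> bool" where
  "intertwines_s_poly \<alpha> \<beta> \<sigma> S \<longleftrightarrow>
     (\<forall>n. S (ae_class (mu \<alpha> \<beta> \<sigma>) (\<lambda>x. poly (s_poly \<alpha> \<beta> \<sigma> n) (of_real x))) = (\<lambda>z. z ^ n))"

definition opZ :: "complex poly \<Rightarrow> complex poly" where
  "opZ p = [:0, 1:] * p"

abbreviation opD :: "complex poly \<Rightarrow> complex poly" where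
  "opD \<equiv> pderiv"

definition opU :: "complex \<Rightarrow> complex \<Rightarrow> real \<Rightarrow> complex poly \<Rightarrow> complex poly" where
  "opU \<alpha> \<beta> \<sigma> p = opZ p + smult \<beta> (opZ (opD p)) + smult (of_real \<sigma> / \<alpha>) p"

definition opV :: "complex \<Rightarrow> complex poly \<Rightarrow> complex poly" where
  "opV \<alpha> p = smult \<alpha> (opD p) + p"

definition rho :: "complex \<Rightarrow> complex \<Rightarrow> real \<Rightarrow> complex poly \<Rightarrow> complex poly" where
  "rho \<alpha> \<beta> \<sigma> p = opU \<alpha> \<beta> \<sigma> (opV \<alpha> p)"

definition poly_graph :: "(complex poly \<Rightarrow> complex poly) \<Rightarrow> (complex \<Rightarrow> complex) op_graph" where
  "poly_graph T = range (\<lambda>p. (poly p, poly (T p)))"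

definition rho_closure :: "complex \<Rightarrow> complex \<Rightarrow> real \<Rightarrow> (complex \<Rightarrow> complex) op_graph" where
  "rho_closure \<alpha> \<beta> \<sigma> = op_closure (fock (eta \<alpha> \<beta>) \<sigma>) (poly_graph (rho \<alpha> \<beta> \<sigma>))"

text \<open>If \<open>\<alpha>\<close> is not real, \<open>rho\<close> itself is not symmetric, and hence cannot be essentially
  self-adjoint: it differs from a symmetric operator by the non-real constant \<open>\<sigma> / \<alpha>\<close>. In
  that case essential self-adjointness is a statement about \<open>rho - \<sigma> / \<alpha>\<close>, whose closure is
  \<open>rho_closure - \<sigma> / \<alpha>\<close>.\<close>

lemma taylor_coeff_poly: "taylor_coeff (poly p) n = coeff p n"
proof -
  have "poly p has_fps_expansion fps_of_poly p"
    by (simp add: has_fps_expansion_def)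
  then have "fps_nth (fps_of_poly p) n = (deriv ^^ n) (poly p) 0 / fact n"
    by (rule fps_nth_fps_expansion)
  then show ?thesis
    by (simp add: taylor_coeff_def fps_expansion_def)
qed

lemma rho_not_symmetric:
  assumes "\<sigma> > 0" "meixner_case \<alpha> \<beta>"
  shows "\<not> symmetric_op (fock (eta \<alpha> \<beta>) \<sigma>) (poly_graph (rho \<alpha> \<beta> \<sigma>))"
proof
  let ?H = "fock (eta \<alpha> \<beta>) \<sigma>"
  let ?c = "of_real \<sigma> / \<alpha> :: complex"
  have r: "rho \<alpha> \<beta> \<sigma> 1 = [:?c, 1:]"
    by (simp add: rho_def opU_def opV_def opZ_def one_pCons)
  have g: "(poly 1, poly [:?c, 1:]) \<in> poly_graph (rho \<alpha> \<beta> \<sigma>)"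
    unfolding poly_graph_def by (rule range_eqI[of _ _ 1]) (simp only: r)
  have one: "taylor_coeff (poly 1) = (\<lambda>n. if n = 0 then 1 else 0)"
    by (auto simp: fun_eq_iff taylor_coeff_poly)
  have c: "taylor_coeff (poly [:?c, 1:]) 0 = ?c"
    by (simp add: taylor_coeff_poly)
  have 1: "ip ?H (poly [:?c, 1:]) (poly 1) = ?c"
    unfolding fock_def ip_space.simps one
    by (subst suminf_finite[of "{0}"]) (auto simp: c gen_ffact_def)
  have 2: "ip ?H (poly 1) (poly [:?c, 1:]) = cnj ?c"
    unfolding fock_def ip_space.simps one
    by (subst suminf_finite[of "{0}"]) (auto simp: c gen_ffact_def)
  assume "symmetric_op ?H (poly_graph (rho \<alpha> \<beta> \<sigma>))"
  with g have "ip ?H (poly [:?c, 1:]) (poly 1) = ip ?H (poly 1) (poly [:?c, 1:])"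
    unfolding symmetric_op_def adjoint_op_def by blast
  then have "?c \<in> \<real>"
    unfolding 1 2 by (simp only: Reals_cnj_iff)
  then have "Im ?c = 0"
    by (simp only: complex_is_Real_iff)
  then show False
    using assms by (simp add: meixner_case_def Im_divide sum_power2_eq_zero_iff)
qed

end

theory Submission
  imports Defs
begin

text \<open>On the coefficients of entire functions \<open>\<rho>\<close> acts as a tridiagonal matrix that is symmetric
  for the weights \<open>n! (\<sigma> | - \<eta>)\<^sub>n\<close>, and its adjoint is the same formal matrix on its maximal
  domain. The off-diagonal entries of the symmetrised matrix grow linearly, so a piecewise linear
  cutoff at scale \<open>k\<close> has a commutator with the matrix that is bounded in \<open>k\<close>; thus truncations
  converge in the graph norm, the closure is the maximal operator, and essential
  self-adjointness follows. On the other side, multiplication by \<open>x\<close> on its maximal domain is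
  self-adjoint, and \<open>S\<close> carries it to a self-adjoint operator that extends \<open>\<rho>\<close> because of the
  recurrence for \<open>s\<^sub>n\<close>. Self-adjoint operators have no proper self-adjoint extensions, so the two
  agree. The measures enter only through the finiteness of their moments; in the Meixner case this
  rests on the exponential decay of \<open>\<Gamma>\<close> on vertical lines.\<close>

section \<open>Operators and unitary equivalence\<close>

text \<open>The symmetrised matrix has off-diagonal entries b(n) = sqrt ((n + 1) (\<sigma> + \<eta>
  n)), of order n. This is close to the limit of Carleman's condition: the sum of 1 / b(n) diverges
  only logarithmically. The cutoff matches this rate, with slope 1 / k on a range where b(n) is of
  order k.

  The coefficient \<open>l\<close> of ZD and the additive constant \<open>c\<close> are left free
  and complex. For every choice the closure of the polynomial operator is the maximal one, and the
  adjoint conjugates both parameters; reality is imposed only at the end. The two claims about the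
  conjugated operator thereby become one: \<sigma> / \<alpha> in the real cases and 0 in the Meixner
  case are both the constant \<open>ell\<close> of the recurrence.\<close>

lemma adjoint_op_antimono: "A \<subseteq> B \<Longrightarrow> adjoint_op H B \<subseteq> adjoint_op H A"
  unfolding adjoint_op_def by auto

text \<open>As \<open>S\<close> is onto, every pair in the adjoint on the side of \<open>K\<close>
  comes from a pair in \<open>H\<close>; as \<open>S\<close> preserves the inner product, the
  defining equations of the two adjoints then agree one by one.\<close>

lemma adjoint_op_unitary_image:
  assumes S: "unitary_op H K S" and A: "A \<subseteq> points H \<times> points H"
  shows "adjoint_op K (map_prod S S ` A) = map_prod S S ` adjoint_op H A"
proof (intro set_eqI iffI)
  have bij: "bij_betw S (points H) (points K)"
    and ip: "\<And>x y. x \<in> points H \<Longrightarrow> y \<in> points H \<Longrightarrow> ip K (S x) (S y) = ip H x y"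
    using S by (auto simp: unitary_op_def)
  {
    fix z assume z: "z \<in> adjoint_op K (map_prod S S ` A)"
    then obtain x y where xy: "z = (S x, S y)" "x \<in> points H" "y \<in> points H"
      using bij unfolding adjoint_op_def bij_betw_def by blast
    have "ip H v x = ip H u y" if "(u, v) \<in> A" for u v
    proof -
      have "ip K (S v) (S x) = ip K (S u) (S y)"
        using z that unfolding xy(1) adjoint_op_def by force
      moreover have "u \<in> points H" "v \<in> points H"
        using that A by auto
      ultimately show ?thesis
        using xy by (simp add: ip)
    qed
    with xy show "z \<in> map_prod S S ` adjoint_op H A"
      by (force simp: adjoint_op_def)
  next
    fix z assume "z \<in> map_prod S S ` adjoint_op H A"
    then obtain x y where xy: "z = (S x, S y)" "x \<in> points H" "y \<in> points H"
      and adj: "\<And>u v. (u, v) \<in> A \<Longrightarrow> ip H v x = ip H u y"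
      unfolding adjoint_op_def by fastforce
    have "ip K (S v) (S x) = ip K (S u) (S y)" if "(u, v) \<in> A" for u v
    proof -
      have "u \<in> points H" "v \<in> points H"
        using that A by auto
      with adj[OF that] xy show ?thesis
        by (simp add: ip)
    qed
    moreover have "S x \<in> points K" "S y \<in> points K"
      using bij xy by (auto simp: bij_betw_def)
    ultimately show "z \<in> adjoint_op K (map_prod S S ` A)"
      unfolding xy(1) adjoint_op_def by auto
  }
qed

text \<open>A self-adjoint operator has no proper self-adjoint extension; hence a self-adjoint \<open>A\<close> that
  extends \<open>G\<close> is determined by \<open>G\<close> as soon as the adjoint of \<open>G\<close> is self-adjoint.\<close>

lemma op_conj_adjoint_eq:
  assumes S: "unitary_op H K S"
    and A: "adjoint_op H A = A"
    and G: "G \<subseteq> map_prod S S ` A"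
    and C: "adjoint_op K G = C" "adjoint_op K C = C"
  shows "op_conj H S C = A"
proof -
  have A': "A \<subseteq> points H \<times> points H"
    by (subst A[symmetric]) (auto simp: adjoint_op_def)
  have inj: "inj_on S (points H)"
    using S by (simp add: unitary_op_def bij_betw_def)
  have adj: "adjoint_op K (map_prod S S ` A) = map_prod S S ` A"
    using adjoint_op_unitary_image[OF S A'] A by simp
  have 1: "map_prod S S ` A \<subseteq> C"
    using adjoint_op_antimono[OF G, of K] adj C by simp
  \<comment> \<open>Taking adjoints reverses the inclusion just obtained and fixes both of its
    sides.\<close>
  have "C \<subseteq> map_prod S S ` A"
    using adjoint_op_antimono[OF 1, of K] adj C by simp
  with 1 have C_eq: "C = map_prod S S ` A"
    by blast
  have "(x, y) \<in> op_conj H S C \<longleftrightarrow> (x, y) \<in> A" for x y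
  proof
    assume "(x, y) \<in> op_conj H S C"
    then obtain w a b where "x \<in> points H" "(a, b) \<in> A" "S x = S a" "w = S b"
      "y = the_inv_into (points H) S w"
      unfolding op_conj_def C_eq by auto
    moreover from this have "a \<in> points H" "b \<in> points H"
      using A' by auto
    ultimately show "(x, y) \<in> A"
      using inj by (auto simp: the_inv_into_f_f dest: inj_onD)
  next
    assume xy: "(x, y) \<in> A"
    then have "x \<in> points H" "y \<in> points H"
      using A' by auto
    then show "(x, y) \<in> op_conj H S C"
      unfolding op_conj_def C_eq using xy inj by (force simp: the_inv_into_f_f)
  qed
  then show ?thesis
    by auto
qed

section \<open>Multiplication by the variable\<close>

lemma norm_add_square_le: "(cmod (a + b))\<^sup>2 \<le> 2 * (cmod a)\<^sup>2 + 2 * (cmod b)\<^sup>2"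
proof -
  have "(cmod (a + b))\<^sup>2 \<le> (cmod a + cmod b)\<^sup>2"
    by (intro power_mono norm_triangle_ineq) auto
  also have "\<dots> \<le> 2 * (cmod a)\<^sup>2 + 2 * (cmod b)\<^sup>2"
    using sum_squares_bound[of "cmod a" "cmod b"] by (simp add: power2_sum)
  finally show ?thesis .
qed

lemma norm_add3_square_le: "(cmod (a + b + c))\<^sup>2 \<le> 2 * (cmod a)\<^sup>2 + 4 * (cmod b)\<^sup>2 + 4 * (cmod c)\<^sup>2"
  using norm_add_square_le[of a "b + c"] norm_add_square_le[of b c] by (simp add: add.assoc)

section \<open>Representatives of square-integrable classes\<close>

lemma measurable_cnj [measurable]: "cnj \<in> borel_measurable borel"
  by (rule borel_measurable_continuous_onI[OF continuous_on_cnj[OF continuous_on_id]])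

text \<open>The choice made by \<open>rep\<close> is arbitrary, so these two facts are all that can
  be used of it; \<open>f\<close> itself shows that there is something to choose from.\<close>

lemma rep_ae_class:
  assumes "f \<in> borel_measurable M"
  shows "rep (ae_class M f) \<in> borel_measurable M" "AE x in M. rep (ae_class M f) x = f x"
proof -
  have "f \<in> ae_class M f"
    using assms by (simp add: ae_class_def)
  then have "rep (ae_class M f) \<in> ae_class M f"
    unfolding rep_def by (rule someI[where P = "\<lambda>g. g \<in> ae_class M f"])
  then show "rep (ae_class M f) \<in> borel_measurable M" "AE x in M. rep (ae_class M f) x = f x"
    by (auto simp: ae_class_def)
qed

lemma ae_class_eqI:
  assumes "AE x in M. f x = g x"
  shows "ae_class M f = ae_class M g"
proof -
  have "(AE x in M. h x = f x) \<longleftrightarrow> (AE x in M. h x = g x)" for h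
  proof
    assume "AE x in M. h x = f x"
    with assms show "AE x in M. h x = g x"
      by eventually_elim simp
  next
    assume "AE x in M. h x = g x"
    with assms show "AE x in M. h x = f x"
      by eventually_elim simp
  qed
  then show ?thesis
    by (simp add: ae_class_def)
qed

lemma square_integrable_measurable: "f \<in> square_integrable M \<Longrightarrow> f \<in> borel_measurable M"
  by (simp add: square_integrable_def)

lemma ae_class_in_points: "f \<in> square_integrable M \<Longrightarrow> ae_class M f \<in> points (L2 M)"
  by (simp add: L2_def)

lemma add_ae_class:
  assumes "f \<in> borel_measurable M" "g \<in> borel_measurable M"
  shows "add (L2 M) (ae_class M f) (ae_class M g) = ae_class M (\<lambda>x. f x + g x)"
  unfolding L2_def ip_space.simps
proof (rule ae_class_eqI)
  show "AE x in M. rep (ae_class M f) x + rep (ae_class M g) x = f x + g x"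
    using rep_ae_class(2)[OF assms(1)] rep_ae_class(2)[OF assms(2)] by eventually_elim simp
qed

lemma scale_ae_class:
  assumes "f \<in> borel_measurable M"
  shows "scale (L2 M) c (ae_class M f) = ae_class M (\<lambda>x. c * f x)"
  unfolding L2_def ip_space.simps
proof (rule ae_class_eqI)
  show "AE x in M. c * rep (ae_class M f) x = c * f x"
    using rep_ae_class(2)[OF assms] by eventually_elim simp
qed

lemma ip_ae_class:
  assumes "f \<in> borel_measurable M" "g \<in> borel_measurable M"
  shows "ip (L2 M) (ae_class M f) (ae_class M g) = (\<integral>x. f x * cnj (g x) \<partial>M)"
  unfolding L2_def ip_space.simps
proof (rule integral_cong_AE)
  have [measurable]: "f \<in> borel_measurable M" "g \<in> borel_measurable M"
    "rep (ae_class M f) \<in> borel_measurable M" "rep (ae_class M g) \<in> borel_measurable M"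
    using assms rep_ae_class by auto
  show "(\<lambda>x. rep (ae_class M f) x * cnj (rep (ae_class M g) x)) \<in> borel_measurable M"
    "(\<lambda>x. f x * cnj (g x)) \<in> borel_measurable M"
    by measurable
  show "AE x in M. rep (ae_class M f) x * cnj (rep (ae_class M g) x) = f x * cnj (g x)"
    using rep_ae_class(2)[OF assms(1)] rep_ae_class(2)[OF assms(2)] by eventually_elim simp
qed

lemma integrable_mult_cnj:
  assumes "f \<in> square_integrable M" "g \<in> square_integrable M"
  shows "integrable M (\<lambda>x. f x * cnj (g x))"
proof (rule Bochner_Integration.integrable_bound)
  show "integrable M (\<lambda>x. (cmod (f x))\<^sup>2 + (cmod (g x))\<^sup>2)"
    using assms by (intro Bochner_Integration.integrable_add) (auto simp: square_integrable_def)
  have [measurable]: "f \<in> borel_measurable M" "g \<in> borel_measurable M"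
    using assms by (auto simp: square_integrable_def)
  show "(\<lambda>x. f x * cnj (g x)) \<in> borel_measurable M"
    by measurable
  have "cmod a * cmod b \<le> (cmod a)\<^sup>2 + (cmod b)\<^sup>2" for a b
    using sum_squares_bound[of "cmod a" "cmod b"] mult_nonneg_nonneg[OF norm_ge_zero[of a] norm_ge_zero[of b]]
    by linarith
  then show "AE x in M. norm (f x * cnj (g x)) \<le> norm ((cmod (f x))\<^sup>2 + (cmod (g x))\<^sup>2)"
    by (simp add: norm_mult)
qed

lemma square_integrable_bounded_mult:
  assumes f: "f \<in> square_integrable M" and b: "b \<in> borel_measurable M"
    and bound: "\<And>x. cmod (b x) \<le> K"
  shows "(\<lambda>x. b x * f x) \<in> square_integrable M"
proof -
  have [measurable]: "f \<in> borel_measurable M" "b \<in> borel_measurable M"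
    using f b by (auto simp: square_integrable_def)
  have "integrable M (\<lambda>x. (cmod (b x * f x))\<^sup>2)"
  proof (rule Bochner_Integration.integrable_bound)
    show "integrable M (\<lambda>x. K\<^sup>2 * (cmod (f x))\<^sup>2)"
      using f by (auto simp: square_integrable_def)
    have "(cmod (b x * f x))\<^sup>2 \<le> K\<^sup>2 * (cmod (f x))\<^sup>2" for x
      unfolding norm_mult power_mult_distrib
      by (intro mult_right_mono power_mono bound) auto
    then show "AE x in M. norm ((cmod (b x * f x))\<^sup>2) \<le> norm (K\<^sup>2 * (cmod (f x))\<^sup>2)"
      by simp
  qed measurable
  then show ?thesis
    by (simp add: square_integrable_def)
qed

lemma square_integrable_diff:
  assumes f: "f \<in> square_integrable M" and g: "g \<in> square_integrable M"
  shows "(\<lambda>x. f x - g x) \<in> square_integrable M"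
proof -
  have [measurable]: "f \<in> borel_measurable M" "g \<in> borel_measurable M"
    using f g by (auto simp: square_integrable_def)
  have "integrable M (\<lambda>x. (cmod (f x - g x))\<^sup>2)"
  proof (rule Bochner_Integration.integrable_bound)
    show "integrable M (\<lambda>x. 2 * (cmod (f x))\<^sup>2 + 2 * (cmod (g x))\<^sup>2)"
      using f g by (auto simp: square_integrable_def)
    have "(cmod (a - b))\<^sup>2 \<le> 2 * (cmod a)\<^sup>2 + 2 * (cmod b)\<^sup>2" for a b
      using norm_add_square_le[of a "- b"] by simp
    then show "AE x in M. norm ((cmod (f x - g x))\<^sup>2) \<le> norm (2 * (cmod (f x))\<^sup>2 + 2 * (cmod (g x))\<^sup>2)"
      by simp
  qed measurable
  then show ?thesis
    by (simp add: square_integrable_def)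
qed

section \<open>The adjoint of multiplication by the variable\<close>

text \<open>The test function is x f - g itself, cut off to |x| \<le> K so that it lies in the
  domain of multiplication. Inserted into the hypothesis it gives its own squared norm, which is
  therefore zero; then K runs through the naturals.\<close>

lemma AE_eq_if_ip_eq:
  assumes id: "(\<lambda>x. x) \<in> borel_measurable M"
    and f: "f \<in> square_integrable M" and g: "g \<in> square_integrable M"
    and adj: "\<And>h. h \<in> square_integrable M \<Longrightarrow> (\<lambda>x. of_real x * h x) \<in> square_integrable M \<Longrightarrow>
      (\<integral>x. of_real x * h x * cnj (f x) \<partial>M) = (\<integral>x. h x * cnj (g x) \<partial>M)"
  shows "AE x in M. of_real x * f x = g x"
proof -
  have [measurable]: "(\<lambda>x. x) \<in> borel_measurable M" "f \<in> borel_measurable M" "g \<in> borel_measurable M"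
    using id f g by (auto simp: square_integrable_def)
  have "AE x in M. \<bar>x\<bar> \<le> real K \<longrightarrow> of_real x * f x = g x" for K :: nat
  proof -
    define c :: "real \<Rightarrow> complex" where "c x = (if \<bar>x\<bar> \<le> real K then 1 else 0)" for x
    define h where "h x = c x * of_real x * f x - c x * g x" for x
    have [measurable]: "c \<in> borel_measurable M"
      unfolding c_def by measurable
    have c: "(\<lambda>x. c x * of_real x) \<in> borel_measurable M" "\<And>x. cmod (c x * of_real x) \<le> K"
      "\<And>x. cmod (c x) \<le> 1"
      by (measurable, auto simp: c_def)
    have h: "h \<in> square_integrable M"
      unfolding h_def
      using square_integrable_diff[OF square_integrable_bounded_mult[OF f c(1,2)]
          square_integrable_bounded_mult[OF g _ c(3)]] by simp
    \<comment> \<open>Since c takes only the values 0 and 1, c h = h, and x h is a bounded multiple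
      of h.\<close>
    have "(\<lambda>x. c x * of_real x * h x) \<in> square_integrable M"
      by (rule square_integrable_bounded_mult[OF h c(1,2)])
    then have xh: "(\<lambda>x. of_real x * h x) \<in> square_integrable M"
      by (rule back_subst[of "\<lambda>f. f \<in> square_integrable M"]) (auto simp: h_def c_def)
    \<comment> \<open>The left side is h times the conjugate of x f - g because x is real, and x f -
      g equals h wherever h is not cut off.\<close>
    have h2: "of_real x * h x * cnj (f x) - h x * cnj (g x) = of_real ((cmod (h x))\<^sup>2)" for x
      unfolding complex_norm_square by (auto simp: h_def c_def algebra_simps)
    have "(\<integral>x. of_real x * h x * cnj (f x) - h x * cnj (g x) \<partial>M) = 0"
      using adj[OF h xh] by (subst Bochner_Integration.integral_diff)
        (auto intro: integrable_mult_cnj h f g xh)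
    then have "(\<integral>x. (cmod (h x))\<^sup>2 \<partial>M) = 0"
      unfolding h2 integral_complex_of_real by (simp only: of_real_eq_0_iff)
    moreover have "integrable M (\<lambda>x. (cmod (h x))\<^sup>2)"
      using h by (simp add: square_integrable_def)
    ultimately have "AE x in M. (cmod (h x))\<^sup>2 = 0"
      by (subst (asm) integral_nonneg_eq_0_iff_AE) auto
    then show ?thesis
      by eventually_elim (auto simp: h_def c_def)
  qed
  then have "AE x in M. \<forall>K::nat. \<bar>x\<bar> \<le> real K \<longrightarrow> of_real x * f x = g x"
    unfolding AE_all_countable by blast
  then show ?thesis
    by eventually_elim (metis real_arch_simple)
qed

text \<open>The adjoint relation supplies only some square-integrable g; its equality with x f
  almost everywhere is what places f in the maximal domain. The converse inclusion holds because x
  is real.\<close>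

lemma adjoint_mult_by_var:
  assumes id: "(\<lambda>x. x) \<in> borel_measurable M"
  shows "adjoint_op (L2 M) (mult_by_var M) = mult_by_var M"
proof (intro set_eqI iffI)
  fix z assume z: "z \<in> adjoint_op (L2 M) (mult_by_var M)"
  then obtain f g where fg: "z = (ae_class M f, ae_class M g)"
    "f \<in> square_integrable M" "g \<in> square_integrable M"
    by (auto simp: adjoint_op_def L2_def)
  have [measurable]: "(\<lambda>x. x) \<in> borel_measurable M" "f \<in> borel_measurable M" "g \<in> borel_measurable M"
    using id fg by (auto simp: square_integrable_def)
  have "AE x in M. of_real x * f x = g x"
  proof (rule AE_eq_if_ip_eq[OF id fg(2,3)])
    fix h assume h: "h \<in> square_integrable M" "(\<lambda>x. of_real x * h x) \<in> square_integrable M"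
    then have "(ae_class M h, ae_class M (\<lambda>x. of_real x * h x)) \<in> mult_by_var M"
      by (auto simp: mult_by_var_def)
    then have "ip (L2 M) (ae_class M (\<lambda>x. of_real x * h x)) (ae_class M f)
        = ip (L2 M) (ae_class M h) (ae_class M g)"
      using z unfolding fg(1) adjoint_op_def by auto
    then show "(\<integral>x. of_real x * h x * cnj (f x) \<partial>M) = (\<integral>x. h x * cnj (g x) \<partial>M)"
      using h fg(2,3) by (simp add: ip_ae_class square_integrable_measurable)
  qed
  then have "AE x in M. g x = of_real x * f x"
    by eventually_elim simp
  then have eq: "ae_class M g = ae_class M (\<lambda>x. of_real x * f x)"
    and "AE x in M. (cmod (g x))\<^sup>2 = (cmod (of_real x * f x))\<^sup>2"
    by (rule ae_class_eqI, eventually_elim) simp_all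
  then have "integrable M (\<lambda>x. (cmod (of_real x * f x))\<^sup>2)"
    using fg(3) by (subst integrable_cong_AE[symmetric]) (auto simp: square_integrable_def)
  then have "(\<lambda>x. of_real x * f x) \<in> square_integrable M"
    by (simp add: square_integrable_def)
  with fg eq show "z \<in> mult_by_var M"
    by (auto simp: mult_by_var_def)
next
  fix z assume "z \<in> mult_by_var M"
  then obtain f where z: "z = (ae_class M f, ae_class M (\<lambda>x. of_real x * f x))"
    and f: "f \<in> square_integrable M" "(\<lambda>x. of_real x * f x) \<in> square_integrable M"
    by (auto simp: mult_by_var_def)
  have "ip (L2 M) (ae_class M (\<lambda>x. of_real x * h x)) (ae_class M f)
      = ip (L2 M) (ae_class M h) (ae_class M (\<lambda>x. of_real x * f x))"
    if "h \<in> square_integrable M" "(\<lambda>x. of_real x * h x) \<in> square_integrable M" for h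
    using that f by (simp add: ip_ae_class square_integrable_measurable mult_ac)
  then show "z \<in> adjoint_op (L2 M) (mult_by_var M)"
    using z f by (auto simp: adjoint_op_def mult_by_var_def ae_class_in_points)
qed

section \<open>Moments of the three families of measures\<close>

text \<open>On the real line |p|^2 is the product of p with the polynomial whose coefficients are
  conjugated, hence again a polynomial, and finite moments suffice.\<close>

lemma square_integrable_poly:
  assumes id: "(\<lambda>x. x) \<in> borel_measurable M"
    and moments: "\<And>k. integrable M (\<lambda>x. x ^ k)"
  shows "(\<lambda>x. poly p (of_real x)) \<in> square_integrable M"
proof -
  have int: "integrable M (\<lambda>x. poly r (of_real x) :: complex)" for r
  proof -
    have "integrable M (\<lambda>x. complex_of_real (x ^ k))" for k
      using moments by (rule integrable_of_real)
    then show ?thesis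
      unfolding poly_altdef by simp
  qed
  have "(cmod (poly p (of_real x)))\<^sup>2 = Re (poly (p * map_poly cnj p) (of_real x))" for x :: real
  proof -
    have "poly (p * map_poly cnj p) (of_real x) = of_real ((cmod (poly p (of_real x)))\<^sup>2)"
      unfolding complex_norm_square by simp
    then show ?thesis
      by simp
  qed
  then have "integrable M (\<lambda>x. (cmod (poly p (of_real x)))\<^sup>2)"
    by (simp only: integrable_Re[OF int])
  moreover have "(\<lambda>x. poly p (of_real x)) \<in> borel_measurable M"
    using int by (rule borel_measurable_integrable)
  ultimately show ?thesis
    by (simp add: square_integrable_def)
qed

section \<open>Negative binomial weights\<close>

lemma gen_ffact_minus_one_pos: "c > 0 \<Longrightarrow> gen_ffact c (-1) n > 0"
  unfolding gen_ffact_def by (intro prod_pos) (auto intro: add_pos_nonneg)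

text \<open>Ratio test. The factor n^k is first enlarged to (n + 1)^k, which does not vanish at n =
  0 and gives quotients \<open>\<rho> n\<close> that tend to q; (q + 1) / 2 lies strictly between q
  and 1.\<close>

lemma negbin_moment_summable:
  fixes q c :: real
  assumes q: "0 < q" "q < 1" and c: "c > 0"
  shows "summable (\<lambda>n. q ^ n * (1 / fact n) * gen_ffact c (-1) n * real n ^ k)"
proof -
  define u where "u n = q ^ n * (1 / fact n) * gen_ffact c (-1) n * (real n + 1) ^ k" for n
  have u_pos: "u n > 0" for n
    using q gen_ffact_minus_one_pos[OF c, of n] by (simp add: u_def)
  define \<rho> where "\<rho> n = (1 + 1 / real (Suc n)) ^ k * q * (1 + (c - 1) / real (Suc n))" for n
  have u_Suc: "u (Suc n) = \<rho> n * u n" for n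
  proof -
    have "(real (Suc n) + 1) ^ k = (1 + 1 / real (Suc n)) ^ k * (real n + 1) ^ k"
      by (simp add: power_mult_distrib[symmetric] field_simps)
    moreover have "1 + (c - 1) / real (Suc n) = (c + real n) / real (Suc n)"
      by (simp add: field_simps)
    ultimately show ?thesis
      unfolding u_def \<rho>_def gen_ffact_def by (simp only: prod.lessThan_Suc fact_Suc) (simp add: mult_ac)
  qed
  have "(\<lambda>n. 1 + a / real (Suc n)) \<longlonglongrightarrow> 1 + 0" for a
    by (intro tendsto_add tendsto_const LIMSEQ_Suc[OF lim_const_over_n])
  then have "\<rho> \<longlonglongrightarrow> 1 ^ k * q * 1"
    unfolding \<rho>_def by (intro tendsto_mult tendsto_power tendsto_const) simp_all
  then have "eventually (\<lambda>n. \<rho> n < (q + 1) / 2) sequentially"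
    by (rule order_tendstoD) (use q in simp)
  then obtain N where N: "\<And>n. n \<ge> N \<Longrightarrow> \<rho> n < (q + 1) / 2"
    by (auto simp: eventually_sequentially)
  have "summable u"
  proof (rule summable_ratio_test)
    show "(q + 1) / 2 < 1"
      using q by simp
    show "norm (u (Suc n)) \<le> (q + 1) / 2 * norm (u n)" if "n \<ge> N" for n
      using N[OF that] u_pos[of n] u_pos[of "Suc n"] unfolding u_Suc
      by simp
  qed
  then show ?thesis
  proof (rule summable_comparison_test[rotated])
    have "norm (q ^ n * (1 / fact n) * gen_ffact c (-1) n * real n ^ k) \<le> u n" for n
    proof -
      have g: "0 < q ^ n * (1 / fact n) * gen_ffact c (-1) n"
        using q gen_ffact_minus_one_pos[OF c, of n] by simp
      have "real n ^ k \<le> (real n + 1) ^ k"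
        by (intro power_mono) auto
      then show ?thesis
        using mult_left_mono[OF _ less_imp_le[OF g]] g unfolding u_def norm_mult[of _ "real n ^ k"]
        by (simp only: real_norm_def abs_of_pos) simp
    qed
    then show "\<exists>N. \<forall>n\<ge>N. norm (q ^ n * (1 / fact n) * gen_ffact c (-1) n * real n ^ k) \<le> u n"
      by blast
  qed
qed

lemma negbin_moments:
  assumes "\<sigma> > 0" and params: "negbin_case \<alpha> \<beta>"
  shows "(\<lambda>x. x) \<in> borel_measurable (mu \<alpha> \<beta> \<sigma>)" "integrable (mu \<alpha> \<beta> \<sigma>) (\<lambda>x. x ^ k)"
proof -
  let ?d = "Re \<alpha> - Re \<beta>" and ?X = "range (\<lambda>n::nat. (Re \<alpha> - Re \<beta>) * real n)"
    and ?c = "\<sigma> / eta \<alpha> \<beta>"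
  have pos: "0 < Re \<beta>" "Re \<beta> < Re \<alpha>" and eta: "eta \<alpha> \<beta> > 0"
    using params by (auto simp: negbin_case_def eta_def)
  have mu: "mu \<alpha> \<beta> \<sigma> = distr (density (count_space UNIV) (\<lambda>n. ennreal (negbin_weight \<alpha> \<beta> \<sigma> n)))
      (restrict_space borel ?X) (\<lambda>n. ?d * real n)"
    using params by (auto simp: mu_def X_set_def negbin_case_def gamma_case_def meixner_case_def)
  have id: "(\<lambda>x. x) \<in> borel_measurable (restrict_space borel ?X)"
    by (intro measurable_restrict_space1) simp
  then show "(\<lambda>x. x) \<in> borel_measurable (mu \<alpha> \<beta> \<sigma>)"
    unfolding mu by simp
  have "summable (\<lambda>n. (Re \<beta> / Re \<alpha>) ^ n * (1 / fact n) * gen_ffact ?c (-1) n * real n ^ k)"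
    using pos eta assms(1) by (intro negbin_moment_summable) auto
  then have "summable (\<lambda>n. ((1 - Re \<beta> / Re \<alpha>) powr ?c * ?d ^ k) *
      ((Re \<beta> / Re \<alpha>) ^ n * (1 / fact n) * gen_ffact ?c (-1) n * real n ^ k))"
    by (rule summable_mult)
  also have "(\<lambda>n. ((1 - Re \<beta> / Re \<alpha>) powr ?c * ?d ^ k) *
      ((Re \<beta> / Re \<alpha>) ^ n * (1 / fact n) * gen_ffact ?c (-1) n * real n ^ k))
      = (\<lambda>n. negbin_weight \<alpha> \<beta> \<sigma> n * (?d * real n) ^ k)"
    by (simp add: negbin_weight_def power_mult_distrib mult_ac)
  finally have "summable (\<lambda>n. negbin_weight \<alpha> \<beta> \<sigma> n * (?d * real n) ^ k)" .
  moreover have w: "negbin_weight \<alpha> \<beta> \<sigma> n \<ge> 0" for n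
    using pos eta assms(1) gen_ffact_minus_one_pos[of ?c n]
    by (simp add: negbin_weight_def)
  ultimately have "summable (\<lambda>n. norm (negbin_weight \<alpha> \<beta> \<sigma> n *\<^sub>R (?d * real n) ^ k))"
    using pos by (simp add: abs_mult)
  then have "integrable (density (count_space UNIV) (\<lambda>n. ennreal (negbin_weight \<alpha> \<beta> \<sigma> n)))
      (\<lambda>n. (?d * real n) ^ k)"
    using w by (subst integrable_density) (auto simp: integrable_count_space_nat_iff)
  moreover have "(\<lambda>n. ?d * real n) \<in> measurable (density (count_space UNIV)
      (\<lambda>n. ennreal (negbin_weight \<alpha> \<beta> \<sigma> n))) (restrict_space borel ?X)"
    by (intro measurable_restrict_space2) auto
  moreover have "(\<lambda>x. x ^ k) \<in> borel_measurable (restrict_space borel ?X)"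
    using id by (rule borel_measurable_power)
  ultimately show "integrable (mu \<alpha> \<beta> \<sigma>) (\<lambda>x. x ^ k)"
    unfolding mu by (subst integrable_distr_eq)
qed

section \<open>Gamma density\<close>

text \<open>This is the modulus of Euler's integrand at a real argument. Absolute integrability is
  known for Lebesgue measure and passes to \<open>lborel\<close> because the function is
  Borel.\<close>

lemma integrable_powr_exp:
  fixes z a :: real
  assumes "z > 0" "a > 0"
  shows "integrable lborel (\<lambda>x. indicator {0<..} x * (x powr (z - 1) * exp (- (a * x))))"
proof -
  have "set_integrable lebesgue {0<..} (\<lambda>t. of_real t powr (complex_of_real z - 1) / of_real (exp (a * t)))"
    using absolutely_integrable_Gamma_integral[of "of_real z" a] assms by simp
  then have "integrable lebesgue (\<lambda>x. norm (indicator {0<..} x *\<^sub>R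
      (of_real x powr (complex_of_real z - 1) / of_real (exp (a * x)))))"
    unfolding set_integrable_def by (rule integrable_norm)
  also have "(\<lambda>x. norm (indicator {0<..} x *\<^sub>R
      (of_real x powr (complex_of_real z - 1) / of_real (exp (a * x)))))
      = (\<lambda>x. indicator {0<..} x * (x powr (z - 1) * exp (- (a * x))))"
    by (auto simp: indicator_def norm_divide norm_powr_real_powr exp_minus field_simps fun_eq_iff)
  finally show ?thesis
    by (subst (asm) integrable_completion) measurable
qed

lemma gamma_moments:
  assumes "\<sigma> > 0" and params: "gamma_case \<alpha> \<beta>"
  shows "(\<lambda>x. x) \<in> borel_measurable (mu \<alpha> \<beta> \<sigma>)" "integrable (mu \<alpha> \<beta> \<sigma>) (\<lambda>x. x ^ k)"
proof -
  let ?c = "\<sigma> / eta \<alpha> \<beta>"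
  have pos: "0 < Re \<alpha>" and eta: "eta \<alpha> \<beta> > 0"
    using params by (auto simp: gamma_case_def eta_def)
  have c: "?c > 0"
    using assms eta by simp
  have mu: "mu \<alpha> \<beta> \<sigma> = density (restrict_space lborel {0<..}) (\<lambda>x. ennreal (gamma_density \<alpha> \<beta> \<sigma> x))"
    using params by (auto simp: mu_def X_set_def gamma_case_def meixner_case_def)
  have id: "(\<lambda>x::real. x) \<in> borel_measurable (restrict_space lborel {0<..})"
    by (intro measurable_restrict_space1) simp
  then show "(\<lambda>x. x) \<in> borel_measurable (mu \<alpha> \<beta> \<sigma>)"
    unfolding mu by simp
  let ?K = "1 / Gamma ?c * Re \<alpha> powr (- \<sigma> / eta \<alpha> \<beta>)"
  \<comment> \<open>The factor x^k only shifts the shape parameter from \<open>?c\<close> to k +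
    \<open>?c\<close>.\<close>
  have "integrable lborel (\<lambda>x. ?K * (indicator {0<..} x *
      (x powr (real k + ?c - 1) * exp (- (1 / Re \<alpha> * x)))))"
    using c pos by (intro integrable_mult_right integrable_powr_exp) auto
  also have "(\<lambda>x. ?K * (indicator {0<..} x * (x powr (real k + ?c - 1) * exp (- (1 / Re \<alpha> * x)))))
      = (\<lambda>x. indicator {0<..} x *\<^sub>R (gamma_density \<alpha> \<beta> \<sigma> x *\<^sub>R x ^ k))"
  proof
    fix x :: real
    show "?K * (indicator {0<..} x * (x powr (real k + ?c - 1) * exp (- (1 / Re \<alpha> * x))))
        = indicator {0<..} x *\<^sub>R (gamma_density \<alpha> \<beta> \<sigma> x *\<^sub>R x ^ k)"
    proof (cases "x > 0")
      case True
      then have "x powr (real k + ?c - 1) = x ^ k * x powr (-1 + ?c)"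
        by (simp add: powr_realpow[symmetric] powr_add[symmetric] algebra_simps)
      then show ?thesis
        using True by (simp add: gamma_density_def)
    qed simp
  qed
  finally have "integrable (restrict_space lborel {0<..}) (\<lambda>x. gamma_density \<alpha> \<beta> \<sigma> x *\<^sub>R x ^ k)"
    by (subst integrable_restrict_space) auto
  moreover have "gamma_density \<alpha> \<beta> \<sigma> x \<ge> 0" for x
    unfolding gamma_density_def using Gamma_real_pos[OF c] by (intro mult_nonneg_nonneg) auto
  moreover have "gamma_density \<alpha> \<beta> \<sigma> \<in> borel_measurable (restrict_space lborel {0<..})"
    unfolding gamma_density_def[abs_def] by (intro measurable_restrict_space1) simp
  moreover have "(\<lambda>x::real. x ^ k) \<in> borel_measurable (restrict_space lborel {0<..})"
    using id by (rule borel_measurable_power)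
  ultimately show "integrable (mu \<alpha> \<beta> \<sigma>) (\<lambda>x. x ^ k)"
    unfolding mu by (subst integrable_density) auto
qed

section \<open>Decay of the Gamma function and the Meixner density\<close>

text \<open>By Euler's product, each factor \<open>t / |t + i y|\<close> increases with \<open>t > 0\<close>. This reduces the decay
  of \<open>\<Gamma>\<close> on a vertical line to half-integer abscissae, where the reflection formula applies.\<close>

lemma norm_Gamma_ratio_mono:
  assumes "0 < a" "a \<le> b"
  shows "cmod (Gamma (Complex a y)) / Gamma a \<le> cmod (Gamma (Complex b y)) / Gamma b"
proof -
  define P where "P a n = (\<Prod>i<Suc n. (a + real i) / cmod (Complex (a + real i) y))" for a n
  \<comment> \<open>The factors n! and n^z of Euler's approximants cancel, because the modulus of
    n^(a + iy) is n^a.\<close>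
  have ratio: "cmod (Gamma_series (Complex a y) n) / Gamma_series a n = P a n" if "a > 0" for a n
  proof -
    have "Complex a y + of_nat i = Complex (a + real i) y" for i
      by (simp add: complex_eq_iff)
    then have "cmod (pochhammer (Complex a y) (n + 1)) = (\<Prod>i<Suc n. cmod (Complex (a + real i) y))"
      by (simp add: pochhammer_prod prod_norm[symmetric] atLeast0LessThan del: prod.lessThan_Suc)
    moreover have "pochhammer a (n + 1) = (\<Prod>i<Suc n. a + real i)"
      by (simp add: pochhammer_prod atLeast0LessThan del: prod.lessThan_Suc)
    moreover have "(\<Prod>i<Suc n. a + real i) > 0"
      using that by (intro prod_pos) (auto intro: add_pos_nonneg)
    moreover have "(\<Prod>i<Suc n. cmod (Complex (a + real i) y)) > 0"
      using that by (intro prod_pos) (auto simp: complex_eq_iff add_nonneg_eq_0_iff)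
    ultimately show ?thesis
      unfolding Gamma_series_def P_def prod_dividef
      by (simp add: norm_mult norm_divide field_simps del: prod.lessThan_Suc)
  qed
  have lim: "P a \<longlonglongrightarrow> cmod (Gamma (Complex a y)) / Gamma a" if "a > 0" for a
  proof -
    have "(\<lambda>n. cmod (Gamma_series (Complex a y) n) / Gamma_series a n)
        \<longlonglongrightarrow> cmod (Gamma (Complex a y)) / Gamma a"
      using Gamma_real_pos[OF that] by (intro tendsto_intros) auto
    then show ?thesis
      by (simp add: ratio[OF that])
  qed
  \<comment> \<open>Squaring and cross-multiplying leaves s^2 y^2 \<le> t^2 y^2.\<close>
  have step: "s / cmod (Complex s y) \<le> t / cmod (Complex t y)" if "0 < s" "s \<le> t" for s t
  proof -
    have "s\<^sup>2 \<le> t\<^sup>2"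
      using that by (intro power_mono) auto
    then have "(s * cmod (Complex t y))\<^sup>2 \<le> (t * cmod (Complex s y))\<^sup>2"
      using mult_right_mono[of "s\<^sup>2" "t\<^sup>2" "y\<^sup>2"]
      by (simp add: power_mult_distrib cmod_power2 algebra_simps)
    then have "s * cmod (Complex t y) \<le> t * cmod (Complex s y)"
      by (rule power2_le_imp_le) (use that in simp)
    moreover have "cmod (Complex s y) > 0" "cmod (Complex t y) > 0"
      using that by (auto simp: complex_eq_iff)
    ultimately show ?thesis
      by (simp add: field_simps)
  qed
  have "P a n \<le> P b n" for n
    unfolding P_def using assms by (intro prod_mono conjI step divide_nonneg_nonneg) auto
  then show ?thesis
    using lim assms by (intro LIMSEQ_le[OF lim lim]) auto
qed

text \<open>On the line Re z = 1/2 one has 1 - z = cnj z, so the reflection formula evaluates the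
  squared modulus exactly as pi / cosh (pi y).\<close>

lemma norm_Gamma_half_le:
  "(cmod (Gamma (Complex (1/2) y)))\<^sup>2 \<le> 2 * pi * exp (- pi * \<bar>y\<bar>)"
proof -
  let ?z = "Complex (1/2) y"
  have "1 - ?z = cnj ?z"
    by (simp add: complex_eq_iff)
  then have "Gamma ?z * cnj (Gamma ?z) = of_real pi / sin (of_real pi * ?z)"
    using Gamma_reflection_complex[of ?z] by (simp add: cnj_Gamma)
  \<comment> \<open>In this form the complementary angle turns the sine into the cosine of an
    imaginary number, that is, into cosh.\<close>
  moreover have "of_real pi * ?z = of_real pi / 2 - (- (\<i> * of_real (pi * y)))"
    by (simp add: complex_eq_iff)
  then have "sin (of_real pi * ?z) = of_real (cosh (pi * y))"
    by (simp only: sin_cos_eq[symmetric] cos_sin_eq[symmetric] cos_minus)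
      (simp add: cosh_def cos_exp_eq scaleR_conv_of_real flip: exp_of_real)
  ultimately have "complex_of_real ((cmod (Gamma ?z))\<^sup>2) = of_real (pi / cosh (pi * y))"
    unfolding complex_norm_square by simp
  then have "(cmod (Gamma ?z))\<^sup>2 = pi / cosh (pi * y)"
    by (simp only: of_real_eq_iff)
  also have "\<dots> \<le> pi / (exp (pi * \<bar>y\<bar>) / 2)"
  proof (rule divide_left_mono)
    have "cosh (pi * y) = cosh (pi * \<bar>y\<bar>)"
      by (simp add: abs_if)
    also have "\<dots> \<ge> exp (pi * \<bar>y\<bar>) / 2"
      by (simp add: cosh_field_def)
    finally show "exp (pi * \<bar>y\<bar>) / 2 \<le> cosh (pi * y)" .
  qed auto
  also have "\<dots> = 2 * pi * exp (- pi * \<bar>y\<bar>)"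
    by (simp add: exp_minus field_simps)
  finally show ?thesis .
qed

text \<open>A single term of the exponential series is kept. The estimate serves to absorb
  polynomial factors at the price of an arbitrarily small exponential rate.\<close>

lemma power_le_exp:
  fixes c \<epsilon> t :: real
  assumes "\<epsilon> > 0" "c \<ge> 0" "t \<ge> 0"
  shows "(c + t) ^ k \<le> fact k / \<epsilon> ^ k * exp (\<epsilon> * c) * exp (\<epsilon> * t)"
proof -
  have "(\<epsilon> * (c + t)) ^ k / fact k \<le> exp (\<epsilon> * (c + t))"
  proof -
    have "(\<lambda>n. (\<epsilon> * (c + t)) ^ n /\<^sub>R fact n) sums exp (\<epsilon> * (c + t))"
      by (rule exp_converges)
    then have "(\<epsilon> * (c + t)) ^ k /\<^sub>R fact k \<le> exp (\<epsilon> * (c + t))"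
      using sum_le_suminf[of "\<lambda>n. (\<epsilon> * (c + t)) ^ n /\<^sub>R fact n" "{k}"] assms
      by (simp add: sums_iff)
    then show ?thesis
      by (simp add: field_simps)
  qed
  then have "\<epsilon> ^ k * (c + t) ^ k \<le> fact k * (exp (\<epsilon> * c) * exp (\<epsilon> * t))"
    unfolding power_mult_distrib[symmetric] exp_add[symmetric] distrib_left[symmetric]
    by (simp add: divide_le_eq mult.commute)
  then show ?thesis
    using assms by (simp add: field_simps)
qed

text \<open>Passing from 1/2 to N + 1/2 by the functional equation multiplies \<open>Gamma\<close>
  by a product of N factors linear in y. This polynomial growth is what costs the \<epsilon> in the
  rate.\<close>

lemma norm_Gamma_vertical_decay:
  assumes "a > 0" "\<epsilon> > 0"
  obtains C where "C \<ge> 0" "\<And>y. (cmod (Gamma (Complex a y)))\<^sup>2 \<le> C * exp ((\<epsilon> - pi) * \<bar>y\<bar>)"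
proof -
  obtain N :: nat where N: "a \<le> real N"
    using real_arch_simple by blast
  define b where "b = real N + 1 / 2"
  have b: "b > 0" "a \<le> b"
    using N assms by (auto simp: b_def)
  have Ga: "Gamma a > 0" and Gb: "Gamma b > 0"
    using assms b by (auto intro: Gamma_real_pos)
  \<comment> \<open>The factors come from the comparison of the abscissae a and b, from the
    polynomial of degree 2 N absorbed with rate \<epsilon>, and from the bound on the line Re z =
    1/2.\<close>
  define C where "C = (Gamma a / Gamma b)\<^sup>2 *
    (fact (2 * N) / \<epsilon> ^ (2 * N) * exp (\<epsilon> * (real N + 1)) * (2 * pi))"
  have "(cmod (Gamma (Complex a y)))\<^sup>2 \<le> C * exp ((\<epsilon> - pi) * \<bar>y\<bar>)" for y
  proof -
    let ?h = "Complex (1/2) y"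
    have "?h \<notin> \<int>\<^sub>\<le>\<^sub>0"
      by (auto elim!: nonpos_Ints_cases simp: complex_eq_iff)
    moreover have "?h + of_nat N = Complex b y"
      by (simp add: complex_eq_iff b_def)
    ultimately have Gb_eq: "Gamma (Complex b y) = pochhammer ?h N * Gamma ?h"
      using pochhammer_Gamma[of ?h N] by (simp add: field_simps Gamma_eq_zero_iff)
    have "cmod (pochhammer ?h N) \<le> (real N + 1 + \<bar>y\<bar>) ^ N"
    proof -
      have "cmod (?h + of_nat i) \<le> real N + 1 + \<bar>y\<bar>" if "i < N" for i
      proof -
        have "cmod (?h + of_nat i) \<le> \<bar>Re (?h + of_nat i)\<bar> + \<bar>Im (?h + of_nat i)\<bar>"
          by (rule cmod_le)
        then show ?thesis
          using that by simp
      qed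
      then have "(\<Prod>i<N. cmod (?h + of_nat i)) \<le> (\<Prod>i<N. real N + 1 + \<bar>y\<bar>)"
        by (intro prod_mono) auto
      then show ?thesis
        by (simp add: pochhammer_prod prod_norm[symmetric] atLeast0LessThan)
    qed
    then have "(cmod (pochhammer ?h N))\<^sup>2 \<le> ((real N + 1 + \<bar>y\<bar>) ^ N)\<^sup>2"
      by (intro power_mono) auto
    also have "\<dots> = (real N + 1 + \<bar>y\<bar>) ^ (2 * N)"
      by (simp add: power_mult[symmetric] mult.commute)
    also have "\<dots> \<le> fact (2 * N) / \<epsilon> ^ (2 * N) * exp (\<epsilon> * (real N + 1)) * exp (\<epsilon> * \<bar>y\<bar>)"
      using assms by (intro power_le_exp) auto
    finally have "(cmod (Gamma (Complex b y)))\<^sup>2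
        \<le> (fact (2 * N) / \<epsilon> ^ (2 * N) * exp (\<epsilon> * (real N + 1)) * exp (\<epsilon> * \<bar>y\<bar>))
          * (2 * pi * exp (- pi * \<bar>y\<bar>))"
      unfolding Gb_eq norm_mult power_mult_distrib
      using norm_Gamma_half_le assms by (intro mult_mono) auto
    then have "(Gamma a / Gamma b)\<^sup>2 * (cmod (Gamma (Complex b y)))\<^sup>2
        \<le> (Gamma a / Gamma b)\<^sup>2 *
          ((fact (2 * N) / \<epsilon> ^ (2 * N) * exp (\<epsilon> * (real N + 1)) * exp (\<epsilon> * \<bar>y\<bar>))
          * (2 * pi * exp (- pi * \<bar>y\<bar>)))"
      by (rule mult_left_mono) simp
    also have "\<dots> = C * (exp (\<epsilon> * \<bar>y\<bar>) * exp (- pi * \<bar>y\<bar>))"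
      by (simp only: C_def mult_ac)
    also have "exp (\<epsilon> * \<bar>y\<bar>) * exp (- pi * \<bar>y\<bar>) = exp ((\<epsilon> - pi) * \<bar>y\<bar>)"
      by (simp add: exp_add[symmetric] algebra_simps)
    finally have "(Gamma a / Gamma b * cmod (Gamma (Complex b y)))\<^sup>2 \<le> C * exp ((\<epsilon> - pi) * \<bar>y\<bar>)"
      by (simp only: power_mult_distrib)
    moreover have "cmod (Gamma (Complex a y)) \<le> Gamma a / Gamma b * cmod (Gamma (Complex b y))"
      using norm_Gamma_ratio_mono[OF assms(1) b(2), of y] Ga Gb by (simp add: field_simps)
    then have "(cmod (Gamma (Complex a y)))\<^sup>2 \<le> (Gamma a / Gamma b * cmod (Gamma (Complex b y)))\<^sup>2"
      by (intro power_mono) auto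
    ultimately show ?thesis
      by linarith
  qed
  moreover have "C \<ge> 0"
    using assms by (simp add: C_def)
  ultimately show ?thesis
    using that by blast
qed

lemma integrable_exp_abs:
  fixes \<delta> :: real
  assumes "\<delta> > 0"
  shows "integrable lborel (\<lambda>x. exp (- \<delta> * \<bar>x\<bar>))"
proof -
  let ?g = "\<lambda>x::real. indicator {0..} x *\<^sub>R exp (- \<delta> * x)"
  have "(\<lambda>x. exp (- \<delta> * x)) absolutely_integrable_on {0..}"
    using integrable_on_exp_minus_to_infinity[OF assms]
    by (intro nonnegative_absolutely_integrable_1) auto
  then have g: "integrable lborel ?g"
    unfolding set_integrable_def by (subst (asm) integrable_completion) measurable
  \<comment> \<open>The sum of the one-sided exponential and its reflection takes the value 2 at the
    origin, so it serves as a majorant.\<close>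
  then have "integrable lborel (\<lambda>x. ?g x + ?g (0 + (-1) * x))"
    by (intro Bochner_Integration.integrable_add lborel_integrable_real_affine) auto
  then show ?thesis
    by (rule Bochner_Integration.integrable_bound) (auto simp: indicator_def)
qed

text \<open>With \<theta> = Arg \<alpha> and y the imaginary part of the argument of
  \<open>Gamma\<close>, the rates in |y| are pi - 2 \<theta> from the exponential weight, \<theta> -
  pi from the squared modulus of \<open>Gamma\<close> (decay lemma with \<epsilon> = \<theta>), and
  \<theta> / 2 from the power. They add up to - \<theta> / 2. As |x| \<le> 2 Im \<alpha> (|c| +
  |y|), this becomes the rate \<theta> / (4 Im \<alpha>) in |x|.\<close>

lemma meixner_density_decay:
  assumes "\<sigma> > 0" and params: "meixner_case \<alpha> \<beta>"
  obtains C \<delta> where "\<delta> > 0" "\<And>x. \<bar>meixner_density \<alpha> \<beta> \<sigma> x * x ^ k\<bar> \<le> C * exp (- \<delta> * \<bar>x\<bar>)"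
proof -
  let ?m = "Im \<alpha>" and ?\<eta> = "eta \<alpha> \<beta>" and ?\<theta> = "Arg \<alpha>"
  have m: "?m > 0" and re: "Re \<alpha> \<ge> 0" and \<beta>: "\<beta> = cnj \<alpha>"
    using params by (auto simp: meixner_case_def)
  have \<eta>: "?\<eta> > 0"
    using m by (simp add: eta_def \<beta> add_nonneg_pos power2_eq_square[symmetric])
  \<comment> \<open>The lower bound makes the total rate negative; the upper one makes pi - 2
    \<theta> nonnegative, so that the exponential weight may be estimated through absolute
    values.\<close>
  have \<theta>: "0 < ?\<theta>" "?\<theta> \<le> pi / 2"
  proof -
    show "0 < ?\<theta>"
      using Arg_lt_pi[of \<alpha>] m by simp
    show "?\<theta> \<le> pi / 2"
      using Re_Ln_pos_le re m Arg_def by (metis Arg_eq_Im_Ln abs_le_D1 less_irrefl zero_complex.sel(2))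
  qed
  \<comment> \<open>As \<beta> = cnj \<alpha>, its imaginary part gives the argument of
    \<open>Gamma\<close> the constant real part \<open>a\<close>, and its real part shifts the
    imaginary part by \<open>c\<close>.\<close>
  define c where "c = \<sigma> * Re \<alpha> / (2 * ?\<eta> * ?m)"
  define a where "a = \<sigma> / (2 * ?\<eta>)"
  define y where "y x = x / (2 * ?m) + c" for x
  have a: "a > 0"
    using assms(1) \<eta> by (simp add: a_def)
  have arg: "\<i> * of_real x / of_real (2 * ?m) + \<i> * of_real \<sigma> * \<beta> / of_real (2 * ?\<eta> * ?m)
      = Complex a (y x)" for x
    using m \<eta> by (simp add: complex_eq_iff a_def y_def c_def \<beta>)
  obtain B where B: "B \<ge> 0" "\<And>y. (cmod (Gamma (Complex a y)))\<^sup>2 \<le> B * exp ((?\<theta> - pi) * \<bar>y\<bar>)"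
    using norm_Gamma_vertical_decay[OF a \<theta>(1)] by blast
  define K where "K = fact k / (?\<theta> / 2) ^ k * exp (?\<theta> / 2 * \<bar>c\<bar>)"
  define L where "L = \<bar>meixner_const \<alpha> \<beta> \<sigma>\<bar> * exp ((pi - 2 * ?\<theta>) * \<bar>c\<bar>) * B * ((2 * ?m) ^ k * K)
    * exp (?\<theta> / 2 * \<bar>c\<bar>)"
  show ?thesis
  proof (rule that)
    show "?\<theta> / (4 * ?m) > 0"
      using \<theta> m by simp
    fix x
    have x: "x = 2 * ?m * (y x - c)"
      using m by (simp add: y_def)
    have "\<bar>x\<bar> = 2 * ?m * \<bar>y x - c\<bar>"
      by (subst x) (use m in \<open>simp add: abs_mult\<close>)
    also have "\<dots> \<le> 2 * ?m * (\<bar>c\<bar> + \<bar>y x\<bar>)"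
      using m by (intro mult_left_mono) auto
    finally have x_le: "\<bar>x\<bar> \<le> 2 * ?m * (\<bar>c\<bar> + \<bar>y x\<bar>)" .
    have "\<bar>x\<bar> ^ k \<le> (2 * ?m * (\<bar>c\<bar> + \<bar>y x\<bar>)) ^ k"
      using x_le by (intro power_mono) auto
    also have "\<dots> \<le> (2 * ?m) ^ k * (K * exp (?\<theta> / 2 * \<bar>y x\<bar>))"
      unfolding power_mult_distrib[of _ "\<bar>c\<bar> + \<bar>y x\<bar>"] K_def
      using m \<theta> by (intro mult_left_mono power_le_exp) auto
    finally have xk: "\<bar>x\<bar> ^ k \<le> (2 * ?m) ^ k * K * exp (?\<theta> / 2 * \<bar>y x\<bar>)"
      by simp
    have "(pi / 2 - ?\<theta>) * x / ?m = (pi - 2 * ?\<theta>) * (y x - c)"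
      using m by (subst x) (simp add: field_simps)
    also have "\<dots> \<le> (pi - 2 * ?\<theta>) * (\<bar>c\<bar> + \<bar>y x\<bar>)"
      using \<theta> by (intro mult_left_mono) auto
    finally have e: "exp ((pi / 2 - ?\<theta>) * x / ?m)
        \<le> exp ((pi - 2 * ?\<theta>) * \<bar>c\<bar>) * exp ((pi - 2 * ?\<theta>) * \<bar>y x\<bar>)"
      by (simp add: exp_add[symmetric] algebra_simps)
    have "\<bar>meixner_density \<alpha> \<beta> \<sigma> x * x ^ k\<bar> = \<bar>meixner_const \<alpha> \<beta> \<sigma>\<bar> *
        exp ((pi / 2 - ?\<theta>) * x / ?m) * (cmod (Gamma (Complex a (y x))))\<^sup>2 * \<bar>x\<bar> ^ k"
      unfolding meixner_density_def arg by (simp add: abs_mult power_abs)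
    also have "\<dots> \<le> \<bar>meixner_const \<alpha> \<beta> \<sigma>\<bar> *
        (exp ((pi - 2 * ?\<theta>) * \<bar>c\<bar>) * exp ((pi - 2 * ?\<theta>) * \<bar>y x\<bar>)) *
        (B * exp ((?\<theta> - pi) * \<bar>y x\<bar>)) * ((2 * ?m) ^ k * K * exp (?\<theta> / 2 * \<bar>y x\<bar>))"
      using B by (intro mult_mono mult_left_mono e xk) auto
    also have "\<dots> = \<bar>meixner_const \<alpha> \<beta> \<sigma>\<bar> * exp ((pi - 2 * ?\<theta>) * \<bar>c\<bar>) * B * ((2 * ?m) ^ k * K) *
        (exp ((pi - 2 * ?\<theta>) * \<bar>y x\<bar>) * exp ((?\<theta> - pi) * \<bar>y x\<bar>) * exp (?\<theta> / 2 * \<bar>y x\<bar>))"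
      by (simp only: mult_ac)
    also have "exp ((pi - 2 * ?\<theta>) * \<bar>y x\<bar>) * exp ((?\<theta> - pi) * \<bar>y x\<bar>) * exp (?\<theta> / 2 * \<bar>y x\<bar>)
        = exp (- (?\<theta> / 2) * \<bar>y x\<bar>)"
      by (simp add: exp_add[symmetric] algebra_simps)
    also have "\<bar>meixner_const \<alpha> \<beta> \<sigma>\<bar> * exp ((pi - 2 * ?\<theta>) * \<bar>c\<bar>) * B * ((2 * ?m) ^ k * K) *
        exp (- (?\<theta> / 2) * \<bar>y x\<bar>) \<le>
        \<bar>meixner_const \<alpha> \<beta> \<sigma>\<bar> * exp ((pi - 2 * ?\<theta>) * \<bar>c\<bar>) * B * ((2 * ?m) ^ k * K) *
        (exp (?\<theta> / 2 * \<bar>c\<bar>) * exp (- (?\<theta> / (4 * ?m)) * \<bar>x\<bar>))"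
    proof (rule mult_left_mono)
      have "?\<theta> / (4 * ?m) * \<bar>x\<bar> \<le> ?\<theta> / (4 * ?m) * (2 * ?m * (\<bar>c\<bar> + \<bar>y x\<bar>))"
        using m \<theta> by (intro mult_left_mono x_le) auto
      also have "\<dots> = ?\<theta> / 2 * \<bar>c\<bar> + ?\<theta> / 2 * \<bar>y x\<bar>"
        using m by (simp add: field_simps)
      finally show "exp (- (?\<theta> / 2) * \<bar>y x\<bar>)
          \<le> exp (?\<theta> / 2 * \<bar>c\<bar>) * exp (- (?\<theta> / (4 * ?m)) * \<bar>x\<bar>)"
        by (simp add: exp_add[symmetric])
    qed (use B m \<theta> in \<open>simp add: K_def\<close>)
    finally show "\<bar>meixner_density \<alpha> \<beta> \<sigma> x * x ^ k\<bar> \<le> L * exp (- (?\<theta> / (4 * ?m)) * \<bar>x\<bar>)"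
      by (simp only: L_def mult.assoc)
  qed
qed

lemma meixner_moments:
  assumes "\<sigma> > 0" and params: "meixner_case \<alpha> \<beta>"
  shows "(\<lambda>x. x) \<in> borel_measurable (mu \<alpha> \<beta> \<sigma>)" "integrable (mu \<alpha> \<beta> \<sigma>) (\<lambda>x. x ^ k)"
proof -
  have m: "Im \<alpha> > 0" and re: "Re \<alpha> \<ge> 0" and \<beta>: "\<beta> = cnj \<alpha>"
    using params by (auto simp: meixner_case_def)
  have \<eta>: "eta \<alpha> \<beta> > 0"
    using m by (simp add: eta_def \<beta> add_nonneg_pos power2_eq_square[symmetric])
  have mu: "mu \<alpha> \<beta> \<sigma> = density lborel (\<lambda>x. ennreal (meixner_density \<alpha> \<beta> \<sigma> x))"
  proof -
    have "restrict_space lborel UNIV = (lborel :: real measure)"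
      by (rule measure_eqI) (simp_all add: emeasure_restrict_space)
    then show ?thesis
      using params by (simp add: mu_def X_set_def)
  qed
  show "(\<lambda>x. x) \<in> borel_measurable (mu \<alpha> \<beta> \<sigma>)"
    unfolding mu by simp
  have nn: "meixner_density \<alpha> \<beta> \<sigma> x \<ge> 0" for x
  proof -
    have "Gamma (\<sigma> / eta \<alpha> \<beta>) > 0"
      using assms(1) \<eta> by (intro Gamma_real_pos) simp
    then show ?thesis
      using m by (simp add: meixner_density_def meixner_const_def)
  qed
  \<comment> \<open>Continuity is wanted for Borel measurability. The argument of
    \<open>Gamma\<close> has real part \<sigma> / (2 \<eta>) > 0 and so avoids the poles.\<close>
  have "continuous_on UNIV (meixner_density \<alpha> \<beta> \<sigma>)"
  proof -
    have "Re (\<i> * of_real x / of_real (2 * Im \<alpha>) +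
        \<i> * of_real \<sigma> * \<beta> / of_real (2 * eta \<alpha> \<beta> * Im \<alpha>)) > 0" for x
      using assms(1) m \<eta> by (simp add: \<beta>)
    then have "\<i> * of_real x / of_real (2 * Im \<alpha>) +
        \<i> * of_real \<sigma> * \<beta> / of_real (2 * eta \<alpha> \<beta> * Im \<alpha>) \<notin> \<int>\<^sub>\<le>\<^sub>0" for x
      by (metis nonpos_Ints_cases Re_complex_of_real complex_Re_of_int not_less of_int_le_0_iff)
    then show ?thesis
      unfolding meixner_density_def[abs_def] using m \<eta>
      by (intro continuous_intros continuous_on_compose2[OF continuous_on_Gamma[of "- \<int>\<^sub>\<le>\<^sub>0"]]) auto
  qed
  then have meas [measurable]: "meixner_density \<alpha> \<beta> \<sigma> \<in> borel_measurable borel"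
    by (rule borel_measurable_continuous_onI)
  obtain C \<delta> where "\<delta> > 0" and
    C: "\<And>x. \<bar>meixner_density \<alpha> \<beta> \<sigma> x * x ^ k\<bar> \<le> C * exp (- \<delta> * \<bar>x\<bar>)"
    using meixner_density_decay[OF assms, of k] by blast
  have "integrable lborel (\<lambda>x. meixner_density \<alpha> \<beta> \<sigma> x *\<^sub>R x ^ k)"
  proof (rule Bochner_Integration.integrable_bound)
    show "integrable lborel (\<lambda>x. C * exp (- \<delta> * \<bar>x\<bar>))"
      by (intro integrable_mult_right integrable_exp_abs \<open>\<delta> > 0\<close>)
    show "AE x in lborel. norm (meixner_density \<alpha> \<beta> \<sigma> x *\<^sub>R x ^ k) \<le> norm (C * exp (- \<delta> * \<bar>x\<bar>))"
      using C by (intro AE_I2) (auto intro: order_trans[OF _ abs_ge_self])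
  qed simp
  then show "integrable (mu \<alpha> \<beta> \<sigma>) (\<lambda>x. x ^ k)"
    unfolding mu using nn by (subst integrable_density) auto
qed

section \<open>The tridiagonal operator on the Fock space\<close>

text \<open>The coefficient of z^n in (\<sigma> D + \<eta> Z D^2) z^(n + 1). It is also the quotient
  of consecutive weights of the Fock space, and this coincidence is the source of symmetry.\<close>

definition jacobi_coeff :: "real \<Rightarrow> real \<Rightarrow> nat \<Rightarrow> real" where
  "jacobi_coeff \<eta> \<sigma> n = (real n + 1) * (\<sigma> + \<eta> * real n)"

text \<open>The formal matrix acts on arbitrary sequences, since the image of the coefficients of a
  Fock space element need not belong to the space. At n = 0 there is no predecessor, hence the
  default 0.\<close>

definition three_term ::
  "real \<Rightarrow> real \<Rightarrow> complex \<Rightarrow> complex \<Rightarrow> (nat \<Rightarrow> complex) \<Rightarrow> nat \<Rightarrow> complex" where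
  "three_term \<eta> \<sigma> l c f n = (case n of 0 \<Rightarrow> 0 | Suc m \<Rightarrow> f m) + (l * of_nat n + c) * f n
     + of_real (jacobi_coeff \<eta> \<sigma> n) * f (Suc n)"

text \<open>The operator \<rho> with its additive constant left free, so that \<rho> and \<rho> -
  \<sigma> / \<alpha> are both instances.\<close>

definition jacobi_poly_op ::
  "real \<Rightarrow> real \<Rightarrow> complex \<Rightarrow> complex \<Rightarrow> complex poly \<Rightarrow> complex poly" where
  "jacobi_poly_op \<eta> \<sigma> l c p = opZ p + smult l (opZ (opD p)) + smult c p
     + smult (of_real \<sigma>) (opD p) + smult (of_real \<eta>) (opZ (opD (opD p)))"

lemma coeff_jacobi_poly_op:
  "coeff (jacobi_poly_op \<eta> \<sigma> l c p) = three_term \<eta> \<sigma> l c (coeff p)"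
proof
  fix n
  show "coeff (jacobi_poly_op \<eta> \<sigma> l c p) n = three_term \<eta> \<sigma> l c (coeff p) n"
    by (cases n) (simp_all add: jacobi_poly_op_def three_term_def jacobi_coeff_def opZ_def
        coeff_pderiv algebra_simps)
qed

lemma rho_eq_jacobi_poly_op:
  assumes "\<alpha> \<noteq> 0" "\<alpha> * \<beta> = of_real (eta \<alpha> \<beta>)"
  shows "rho \<alpha> \<beta> \<sigma> p = jacobi_poly_op (eta \<alpha> \<beta>) \<sigma> (\<alpha> + \<beta>) (of_real \<sigma> / \<alpha>) p"
  unfolding rho_def opU_def opV_def jacobi_poly_op_def opZ_def assms(2)[symmetric]
  using assms(1)
  by (simp add: pderiv_add pderiv_smult smult_add_right smult_add_left algebra_simps)

section \<open>The Fock space in terms of Taylor coefficients\<close>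

locale fock_params =
  fixes \<eta> \<sigma> :: real
  assumes \<eta>_pos: "\<eta> > 0" and \<sigma>_pos: "\<sigma> > 0"
begin

abbreviation H where "H \<equiv> fock \<eta> \<sigma>"

definition wt :: "nat \<Rightarrow> real" where
  "wt n = fact n * gen_ffact \<sigma> (- \<eta>) n"

lemma wt_pos: "wt n > 0"
proof -
  have "0 < \<sigma> - real k * - \<eta>" for k
    using \<eta>_pos \<sigma>_pos by (simp add: add_pos_nonneg)
  then show ?thesis
    by (simp add: wt_def gen_ffact_def prod_pos)
qed

lemma wt_Suc: "wt (Suc n) = jacobi_coeff \<eta> \<sigma> n * wt n"
  by (simp add: wt_def gen_ffact_def jacobi_coeff_def algebra_simps)

lemma jacobi_coeff_pos: "jacobi_coeff \<eta> \<sigma> n > 0"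
  unfolding jacobi_coeff_def using \<eta>_pos \<sigma>_pos
  by (intro mult_pos_pos) (auto intro: add_pos_nonneg)

lemma in_points_iff:
  "x \<in> points H \<longleftrightarrow> x holomorphic_on UNIV \<and> summable (\<lambda>n. (cmod (taylor_coeff x n))\<^sup>2 * wt n)"
  by (simp add: fock_def wt_def mult.assoc)

lemma taylor_coeff_add:
  assumes "x \<in> points H" "y \<in> points H"
  shows "taylor_coeff (add H x y) n = taylor_coeff x n + taylor_coeff y n"
  using assms unfolding in_points_iff
  by (simp add: fock_def taylor_coeff_def fps_expansion_def add_divide_distrib
      higher_deriv_add[of _ UNIV])

lemma taylor_coeff_scale:
  assumes "x \<in> points H"
  shows "taylor_coeff (scale H c x) n = c * taylor_coeff x n"
  using assms unfolding in_points_iff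
  by (simp add: fock_def taylor_coeff_def fps_expansion_def higher_deriv_cmult[of _ UNIV])

lemma points_add:
  assumes "x \<in> points H" "y \<in> points H"
  shows "add H x y \<in> points H"
proof -
  have "summable (\<lambda>n. (cmod (taylor_coeff x n + taylor_coeff y n))\<^sup>2 * wt n)"
  proof (rule summable_comparison_test)
    show "summable (\<lambda>n. 2 * ((cmod (taylor_coeff x n))\<^sup>2 * wt n)
        + 2 * ((cmod (taylor_coeff y n))\<^sup>2 * wt n))"
      using assms by (intro summable_add summable_mult) (auto simp: in_points_iff)
    have "(cmod (taylor_coeff x n + taylor_coeff y n))\<^sup>2 * wt n
       \<le> (2 * (cmod (taylor_coeff x n))\<^sup>2 + 2 * (cmod (taylor_coeff y n))\<^sup>2) * wt n" for n
      using wt_pos[of n] by (intro mult_right_mono norm_add_square_le) auto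
    then show "\<exists>N. \<forall>n\<ge>N. norm ((cmod (taylor_coeff x n + taylor_coeff y n))\<^sup>2 * wt n)
        \<le> 2 * ((cmod (taylor_coeff x n))\<^sup>2 * wt n) + 2 * ((cmod (taylor_coeff y n))\<^sup>2 * wt n)"
      using wt_pos by (auto simp: algebra_simps abs_mult less_imp_le)
  qed
  moreover have "add H x y holomorphic_on UNIV"
    using assms unfolding in_points_iff by (auto simp: fock_def intro!: holomorphic_intros)
  ultimately show ?thesis
    using taylor_coeff_add[OF assms] by (simp add: in_points_iff)
qed

lemma points_scale:
  assumes "x \<in> points H"
  shows "scale H c x \<in> points H"
proof -
  have "summable (\<lambda>n. (cmod c)\<^sup>2 * ((cmod (taylor_coeff x n))\<^sup>2 * wt n))"
    using assms by (intro summable_mult) (auto simp: in_points_iff)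
  moreover have "scale H c x holomorphic_on UNIV"
    using assms unfolding in_points_iff by (auto simp: fock_def intro!: holomorphic_intros)
  ultimately show ?thesis
    using taylor_coeff_scale[OF assms]
    by (simp add: in_points_iff norm_mult power_mult_distrib mult.assoc)
qed

lemma poly_in_points: "poly p \<in> points H"
proof -
  have "summable (\<lambda>n. (cmod (coeff p n))\<^sup>2 * wt n)"
    by (rule summable_finite[of "{..degree p}"]) (auto simp: coeff_eq_0)
  then show ?thesis
    by (auto simp: in_points_iff taylor_coeff_poly intro!: holomorphic_intros)
qed

lemma ip_fock:
  "ip H x y = (\<Sum>n. taylor_coeff x n * cnj (taylor_coeff y n) * of_real (wt n))"
  by (simp add: fock_def wt_def)

definition nrm :: "(complex \<Rightarrow> complex) \<Rightarrow> real" where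
  "nrm x = sqrt (\<Sum>n. (cmod (taylor_coeff x n))\<^sup>2 * wt n)"

lemma ip_dist_fock:
  assumes "x \<in> points H" "y \<in> points H"
  shows "ip_dist H x y = sqrt (\<Sum>n. (cmod (taylor_coeff x n - taylor_coeff y n))\<^sup>2 * wt n)"
    and "summable (\<lambda>n. (cmod (taylor_coeff x n - taylor_coeff y n))\<^sup>2 * wt n)"
    and "add H x (scale H (-1) y) \<in> points H"
    and "taylor_coeff (add H x (scale H (-1) y)) n = taylor_coeff x n - taylor_coeff y n"
    and "ip_dist H x y = nrm (add H x (scale H (-1) y))"
proof -
  let ?d = "add H x (scale H (-1) y)"
  show d: "?d \<in> points H"
    using assms by (intro points_add points_scale)
  have t: "taylor_coeff ?d n = taylor_coeff x n - taylor_coeff y n" for n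
    using assms by (simp add: taylor_coeff_add taylor_coeff_scale points_scale)
  then show "taylor_coeff ?d n = taylor_coeff x n - taylor_coeff y n" .
  show s: "summable (\<lambda>n. (cmod (taylor_coeff x n - taylor_coeff y n))\<^sup>2 * wt n)"
    using d by (simp add: in_points_iff t)
  have "ip H ?d ?d = (\<Sum>n. of_real ((cmod (taylor_coeff x n - taylor_coeff y n))\<^sup>2 * wt n))"
    unfolding ip_fock t of_real_mult complex_norm_square ..
  also have "\<dots> = of_real (\<Sum>n. (cmod (taylor_coeff x n - taylor_coeff y n))\<^sup>2 * wt n)"
    by (rule suminf_of_real[OF s, symmetric])
  finally show "ip_dist H x y = sqrt (\<Sum>n. (cmod (taylor_coeff x n - taylor_coeff y n))\<^sup>2 * wt n)"
    by (simp add: ip_dist_def)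
  then show "ip_dist H x y = nrm ?d"
    by (simp add: nrm_def t)
qed

text \<open>The weight is split into two square roots, and the finite inequality is applied to
  partial sums. Summability ensures that the \<open>suminf\<close> in the inner product is a genuine
  sum.\<close>

lemma cauchy_schwarz:
  assumes "x \<in> points H" "y \<in> points H"
  shows "summable (\<lambda>n. taylor_coeff x n * cnj (taylor_coeff y n) * of_real (wt n))"
    and "cmod (ip H x y) \<le> nrm x * nrm y"
proof -
  let ?t = "\<lambda>n. taylor_coeff x n * cnj (taylor_coeff y n) * of_real (wt n)"
  define f g where "f n = cmod (taylor_coeff x n) * sqrt (wt n)"
    and "g n = cmod (taylor_coeff y n) * sqrt (wt n)" for n
  have sq: "(f n)\<^sup>2 = (cmod (taylor_coeff x n))\<^sup>2 * wt n"
    "(g n)\<^sup>2 = (cmod (taylor_coeff y n))\<^sup>2 * wt n" for n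
    using wt_pos[of n] by (simp_all add: f_def g_def power_mult_distrib)
  have sum: "summable (\<lambda>n. (f n)\<^sup>2)" "summable (\<lambda>n. (g n)\<^sup>2)"
    using assms by (simp_all add: sq in_points_iff)
  have nt: "norm (?t n) = \<bar>f n\<bar> * \<bar>g n\<bar>" for n
    using wt_pos[of n] by (simp add: f_def g_def norm_mult abs_mult)
  have bound: "(\<Sum>n<N. norm (?t n)) \<le> nrm x * nrm y" for N
  proof -
    have "(\<Sum>n<N. norm (?t n)) \<le> L2_set f {..<N} * L2_set g {..<N}"
      unfolding nt by (rule L2_set_mult_ineq)
    also have "\<dots> \<le> nrm x * nrm y"
      unfolding L2_set_def nrm_def sq[symmetric]
      by (intro mult_mono real_sqrt_le_mono sum_le_suminf sum) (auto intro!: sum_nonneg suminf_nonneg sum)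
    finally show ?thesis .
  qed
  have s: "summable (\<lambda>n. norm (?t n))"
    by (rule summableI_nonneg_bounded[OF _ bound]) auto
  then show "summable ?t"
    by (rule summable_norm_cancel)
  have "cmod (ip H x y) \<le> (\<Sum>n. norm (?t n))"
    unfolding ip_fock by (rule summable_norm[OF s])
  also have "\<dots> \<le> nrm x * nrm y"
    by (rule suminf_le_const[OF s bound])
  finally show "cmod (ip H x y) \<le> nrm x * nrm y" .
qed

lemma tendsto_ip_left:
  assumes u: "\<And>n. u n \<in> points H" and x: "x \<in> points H" and y: "y \<in> points H"
    and lim: "(\<lambda>n. ip_dist H (u n) x) \<longlonglongrightarrow> 0"
  shows "(\<lambda>n. ip H (u n) y) \<longlonglongrightarrow> ip H x y"
proof (rule Lim_null[THEN iffD2], rule Lim_null_comparison)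
  show "(\<lambda>n. ip_dist H (u n) x * nrm y) \<longlonglongrightarrow> 0"
    using tendsto_mult_left_zero[OF lim] .
  have "norm (ip H (u n) y - ip H x y) \<le> ip_dist H (u n) x * nrm y" for n
  proof -
    let ?d = "add H (u n) (scale H (-1) x)"
    have "ip H ?d y = ip H (u n) y - ip H x y"
      unfolding ip_fock ip_dist_fock(4)[OF u x]
      by (subst suminf_diff[OF cauchy_schwarz(1)[OF u y] cauchy_schwarz(1)[OF x y]])
        (simp add: algebra_simps)
    then show ?thesis
      using cauchy_schwarz(2)[OF ip_dist_fock(3)[OF u[of n] x] y] by (simp add: ip_dist_fock(5)[OF u x])
  qed
  then show "\<forall>\<^sub>F n in sequentially. norm (ip H (u n) y - ip H x y) \<le> ip_dist H (u n) x * nrm y"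
    by simp
qed

text \<open>One summand of the squared distance is at most the whole, so each Taylor coefficient is
  a bounded functional.\<close>

lemma tendsto_taylor_coeff:
  assumes u: "\<And>n. u n \<in> points H" and x: "x \<in> points H"
    and lim: "(\<lambda>n. ip_dist H (u n) x) \<longlonglongrightarrow> 0"
  shows "(\<lambda>n. taylor_coeff (u n) k) \<longlonglongrightarrow> taylor_coeff x k"
proof (rule Lim_null[THEN iffD2], rule Lim_null_comparison)
  show "(\<lambda>n. ip_dist H (u n) x / sqrt (wt k)) \<longlonglongrightarrow> 0"
    using tendsto_divide_zero[OF lim] .
  have "norm (taylor_coeff (u n) k - taylor_coeff x k) \<le> ip_dist H (u n) x / sqrt (wt k)" for n
  proof -
    have "(cmod (taylor_coeff (u n) k - taylor_coeff x k))\<^sup>2 * wt k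
        \<le> (\<Sum>k. (cmod (taylor_coeff (u n) k - taylor_coeff x k))\<^sup>2 * wt k)"
      using sum_le_suminf[OF ip_dist_fock(2)[OF u x], of "{k}" n] wt_pos
      by (simp add: less_imp_le)
    then have "sqrt ((cmod (taylor_coeff (u n) k - taylor_coeff x k))\<^sup>2 * wt k) \<le> ip_dist H (u n) x"
      unfolding ip_dist_fock(1)[OF u x] by (rule real_sqrt_le_mono)
    then show ?thesis
      using wt_pos[of k] by (simp add: real_sqrt_mult field_simps)
  qed
  then show "\<forall>\<^sub>F n in sequentially.
      norm (taylor_coeff (u n) k - taylor_coeff x k) \<le> ip_dist H (u n) x / sqrt (wt k)"
    by simp
qed

text \<open>The equations that define the adjoint survive limits because the inner product is
  continuous in its first argument; constant sequences give the other inclusion.\<close>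

lemma adjoint_op_closure:
  assumes T: "T \<subseteq> points H \<times> points H"
  shows "adjoint_op H (op_closure H T) = adjoint_op H T"
proof
  have "T \<subseteq> op_closure H T"
  proof
    fix z assume z: "z \<in> T"
    then obtain x y where xy: "z = (x, y)" "x \<in> points H" "y \<in> points H"
      using T by auto
    then have "ip_dist H x x = 0" "ip_dist H y y = 0"
      by (simp_all add: ip_dist_fock)
    then have "(\<lambda>n::nat. ip_dist H x x) \<longlonglongrightarrow> 0" "(\<lambda>n::nat. ip_dist H y y) \<longlonglongrightarrow> 0"
      by simp_all
    moreover have "\<forall>n::nat. (x, y) \<in> T"
      using z xy by simp
    ultimately have "\<exists>u v. (\<forall>n::nat. (u n, v n) \<in> T) \<and>
        (\<lambda>n. ip_dist H (u n) x) \<longlonglongrightarrow> 0 \<and> (\<lambda>n. ip_dist H (v n) y) \<longlonglongrightarrow> 0"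
      by (intro exI[of _ "\<lambda>_. x"] exI[of _ "\<lambda>_. y"]) simp
    with xy show "z \<in> op_closure H T"
      by (simp add: op_closure_def)
  qed
  then show "adjoint_op H (op_closure H T) \<subseteq> adjoint_op H T"
    unfolding adjoint_op_def by auto
next
  show "adjoint_op H T \<subseteq> adjoint_op H (op_closure H T)"
  proof
    fix z assume "z \<in> adjoint_op H T"
    then obtain x y where z: "z = (x, y)" and pts: "x \<in> points H" "y \<in> points H"
      and adj: "\<And>u v. (u, v) \<in> T \<Longrightarrow> ip H v x = ip H u y"
      unfolding adjoint_op_def by blast
    have "ip H v x = ip H u y" if uv: "(u, v) \<in> op_closure H T" for u v
    proof -
      obtain a b where ab: "\<And>n::nat. (a n, b n) \<in> T" "(\<lambda>n. ip_dist H (a n) u) \<longlonglongrightarrow> 0"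
        "(\<lambda>n. ip_dist H (b n) v) \<longlonglongrightarrow> 0" and uv': "u \<in> points H" "v \<in> points H"
        using uv by (auto simp: op_closure_def)
      have pts': "a n \<in> points H" "b n \<in> points H" for n
        using ab(1)[of n] T by auto
      have "(\<lambda>n. ip H (b n) x) \<longlonglongrightarrow> ip H v x" "(\<lambda>n. ip H (a n) y) \<longlonglongrightarrow> ip H u y"
        using tendsto_ip_left pts pts' ab uv' by blast+
      with adj[OF ab(1)] show ?thesis
        using LIMSEQ_unique by auto
    qed
    with z pts show "z \<in> adjoint_op H (op_closure H T)"
      by (auto simp: adjoint_op_def)
  qed
qed


section \<open>Minimal and maximal operator\<close>

definition max_op :: "complex \<Rightarrow> complex \<Rightarrow> (complex \<Rightarrow> complex) op_graph" where
  "max_op l c = {(x, y) \<in> points H \<times> points H.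
     \<forall>n. taylor_coeff y n = three_term \<eta> \<sigma> l c (taylor_coeff x) n}"

abbreviation R :: "complex \<Rightarrow> complex \<Rightarrow> (complex \<Rightarrow> complex) op_graph" where
  "R l c \<equiv> poly_graph (jacobi_poly_op \<eta> \<sigma> l c)"

lemma poly_graph_subset_points: "poly_graph T \<subseteq> points H \<times> points H"
  unfolding poly_graph_def using poly_in_points by auto

lemma ip_poly_left:
  assumes "degree p \<le> N"
  shows "ip H (poly p) y = (\<Sum>n\<le>N. coeff p n * cnj (taylor_coeff y n) * of_real (wt n))"
  unfolding ip_fock taylor_coeff_poly
  by (rule suminf_finite) (use assms in \<open>auto simp: coeff_eq_0\<close>)

lemma degree_jacobi_poly_op: "degree (jacobi_poly_op \<eta> \<sigma> l c p) \<le> Suc (degree p)"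
  by (rule degree_le) (auto simp: coeff_jacobi_poly_op three_term_def coeff_eq_0 split: nat.split)

text \<open>Summation by parts: \<open>wt (Suc n) = jacobi_coeff \<eta> \<sigma> n * wt n\<close>
  exchanges the two off-diagonals, so the matrix moves to the other factor with its parameters
  conjugated. Only \<open>p\<close> is a polynomial, hence all sums are finite and \<open>x\<close>
  is arbitrary.\<close>

lemma ip_jacobi_poly_op:
  "ip H (poly (jacobi_poly_op \<eta> \<sigma> l c p)) x =
     (\<Sum>n\<le>Suc (degree p). coeff p n *
        cnj (three_term \<eta> \<sigma> (cnj l) (cnj c) (taylor_coeff x) n) * of_real (wt n))"
proof -
  let ?N = "degree p"
  let ?f = "coeff p" and ?J = "\<lambda>n. complex_of_real (jacobi_coeff \<eta> \<sigma> n)"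
    and ?w = "\<lambda>n. complex_of_real (wt n)" and ?x = "\<lambda>n. cnj (taylor_coeff x n)"
  let ?sh = "\<lambda>g n. case n of 0 \<Rightarrow> (0::complex) | Suc m \<Rightarrow> g m"
  have wS: "?w (Suc n) = ?J n * ?w n" for n
    by (simp add: wt_Suc)
  have cs: "cnj (?sh g n) = ?sh (\<lambda>m. cnj (g m)) n" for g n
    by (simp split: nat.split)
  \<comment> \<open>The index shift leaves no boundary term: the shifted sequence vanishes at 0, and
    the coefficients of \<open>p\<close> vanish beyond its degree. The next identity holds for the
    same reason.\<close>
  have up: "(\<Sum>n\<le>Suc ?N. ?sh ?f n * (?x n * ?w n)) = (\<Sum>n\<le>Suc ?N. ?f n * (?J n * ?x (Suc n) * ?w n))"
    by (subst sum.atMost_Suc_shift) (simp add: coeff_eq_0 wS mult_ac)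
  have down: "(\<Sum>n\<le>Suc ?N. ?f n * (?sh ?x n * ?w n)) = (\<Sum>n\<le>Suc ?N. ?J n * ?f (Suc n) * (?x n * ?w n))"
    by (subst sum.atMost_Suc_shift) (simp add: coeff_eq_0 wS mult_ac)
  have "ip H (poly (jacobi_poly_op \<eta> \<sigma> l c p)) x = (\<Sum>n\<le>Suc ?N. ?sh ?f n * (?x n * ?w n))
     + (\<Sum>n\<le>Suc ?N. (l * of_nat n + c) * ?f n * (?x n * ?w n))
     + (\<Sum>n\<le>Suc ?N. ?J n * ?f (Suc n) * (?x n * ?w n))"
    unfolding ip_poly_left[OF degree_jacobi_poly_op] coeff_jacobi_poly_op three_term_def
      sum.distrib[symmetric]
    by (intro sum.cong refl) (simp add: algebra_simps)
  also have "\<dots> = (\<Sum>n\<le>Suc ?N. ?f n *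
        cnj (three_term \<eta> \<sigma> (cnj l) (cnj c) (taylor_coeff x) n) * of_real (wt n))"
    unfolding up down[symmetric] sum.distrib[symmetric] three_term_def complex_cnj_add cs
    by (intro sum.cong refl) (simp add: algebra_simps)
  finally show ?thesis .
qed

text \<open>Testing against monomials isolates one coefficient at a time, so the adjoint relation is
  the coefficientwise equation of the maximal operator.\<close>

lemma adjoint_R: "adjoint_op H (R l c) = max_op (cnj l) (cnj c)"
proof (intro set_eqI iffI)
  fix z assume "z \<in> adjoint_op H (R l c)"
  then obtain x y where z: "z = (x, y)" and pts: "x \<in> points H" "y \<in> points H"
    and adj: "\<And>p. ip H (poly (jacobi_poly_op \<eta> \<sigma> l c p)) x = ip H (poly p) y"
    unfolding adjoint_op_def poly_graph_def by blast
  have "taylor_coeff y n = three_term \<eta> \<sigma> (cnj l) (cnj c) (taylor_coeff x) n" for n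
  proof -
    let ?t = "three_term \<eta> \<sigma> (cnj l) (cnj c) (taylor_coeff x)"
    have d: "degree (monom (1::complex) n) = n"
      by (simp add: degree_monom_eq)
    have "(\<Sum>m\<le>Suc n. coeff (monom 1 n) m * cnj (?t m) * of_real (wt m))
        = (\<Sum>m\<le>Suc n. coeff (monom 1 n) m * cnj (taylor_coeff y m) * of_real (wt m))"
      using adj[of "monom 1 n"] unfolding ip_jacobi_poly_op d
      by (subst (asm) ip_poly_left[of _ "Suc n"]) (simp_all add: d)
    then have "cnj (?t n) * of_real (wt n) = cnj (taylor_coeff y n) * of_real (wt n)"
      by (simp add: if_distrib[of "\<lambda>a. a * _"] sum.delta cong: if_cong)
    then have "cnj (?t n) = cnj (taylor_coeff y n)"
      using wt_pos[of n] by simp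
    then show ?thesis
      by (metis complex_cnj_cnj)
  qed
  with z pts show "z \<in> max_op (cnj l) (cnj c)"
    by (simp add: max_op_def)
next
  fix z assume "z \<in> max_op (cnj l) (cnj c)"
  then obtain x y where z: "z = (x, y)" and pts: "x \<in> points H" "y \<in> points H"
    and y: "\<And>n. taylor_coeff y n = three_term \<eta> \<sigma> (cnj l) (cnj c) (taylor_coeff x) n"
    by (auto simp: max_op_def)
  have "ip H (poly (jacobi_poly_op \<eta> \<sigma> l c p)) x = ip H (poly p) y" for p
    unfolding ip_jacobi_poly_op y[symmetric] by (rule ip_poly_left[symmetric]) simp
  with z pts show "z \<in> adjoint_op H (R l c)"
    by (auto simp: adjoint_op_def poly_graph_def)
qed

lemma R_subset_max_op: "R l c \<subseteq> max_op l c"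
  unfolding max_op_def poly_graph_def
  by (auto simp: poly_in_points taylor_coeff_poly[abs_def] coeff_jacobi_poly_op)

section \<open>Truncation in the graph norm\<close>

text \<open>The graph falls linearly from 1 at k to 0 at 2 k. For k = 0 division by zero makes it
  constantly 1, which is why \<open>truncate\<close> works with \<open>Suc k\<close>.\<close>

definition cutoff :: "nat \<Rightarrow> nat \<Rightarrow> real" where
  "cutoff k n = max 0 (min 1 (2 - real n / real k))"

lemma cutoff_bounds: "0 \<le> cutoff k n" "cutoff k n \<le> 1"
  by (auto simp: cutoff_def)

lemma cutoff_eq_1: "n \<le> k \<Longrightarrow> cutoff k n = 1"
  using divide_le_eq_1[of "real n" "real k"] by (auto simp: cutoff_def min_def)

lemma cutoff_eq_0: "k > 0 \<Longrightarrow> 2 * k \<le> n \<Longrightarrow> cutoff k n = 0"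
  by (auto simp: cutoff_def le_divide_eq)

text \<open>Where the cutoff still varies, n + 1 \<le> 2 k and \<sigma> + \<eta> n \<le> (\<sigma> +
  2 \<eta>) k; the squared slope 1 / k^2 cancels the k^2, which leaves 2 (\<sigma> + 2
  \<eta>).\<close>

lemma cutoff_step:
  assumes "k > 0"
  shows "(cutoff k (Suc n) - cutoff k n)\<^sup>2 * jacobi_coeff \<eta> \<sigma> n \<le> 2 * \<sigma> + 4 * \<eta>"
proof (cases "n < 2 * k")
  case False
  then show ?thesis
    using assms \<eta>_pos \<sigma>_pos by (simp add: cutoff_eq_0)
next
  case True
  have "\<bar>cutoff k (Suc n) - cutoff k n\<bar> \<le> \<bar>(2 - real (Suc n) / real k) - (2 - real n / real k)\<bar>"
    unfolding cutoff_def by linarith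
  also have "\<dots> = 1 / real k"
    by (simp add: diff_divide_distrib[symmetric] add_divide_distrib)
  finally have "(cutoff k (Suc n) - cutoff k n)\<^sup>2 \<le> (1 / real k)\<^sup>2"
    by (rule power2_le_iff_abs_le[THEN iffD2, rotated]) simp
  moreover have "jacobi_coeff \<eta> \<sigma> n \<le> (2 * real k) * ((\<sigma> + \<eta> * 2) * real k)"
  proof -
    have n: "real n + 1 \<le> 2 * real k"
      using True by linarith
    have "\<sigma> \<le> \<sigma> * real k"
      using assms \<sigma>_pos by simp
    moreover have "\<eta> * real n \<le> \<eta> * (2 * real k)"
      using n \<eta>_pos by (intro mult_left_mono) auto
    ultimately have "\<sigma> + \<eta> * real n \<le> (\<sigma> + \<eta> * 2) * real k"
      by (simp add: algebra_simps)
    then show ?thesis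
      unfolding jacobi_coeff_def using n \<eta>_pos \<sigma>_pos by (intro mult_mono) auto
  qed
  ultimately have "(cutoff k (Suc n) - cutoff k n)\<^sup>2 * jacobi_coeff \<eta> \<sigma> n
      \<le> (1 / real k)\<^sup>2 * ((2 * real k) * ((\<sigma> + \<eta> * 2) * real k))"
    using jacobi_coeff_pos[of n] by (intro mult_mono) auto
  also have "\<dots> = 2 * \<sigma> + 4 * \<eta>"
    using assms by (simp add: power2_eq_square field_simps)
  finally show ?thesis .
qed

definition truncate :: "nat \<Rightarrow> (complex \<Rightarrow> complex) \<Rightarrow> complex poly" where
  "truncate k x = (\<Sum>n<2 * Suc k. monom (of_real (cutoff (Suc k) n) * taylor_coeff x n) n)"

lemma coeff_truncate: "coeff (truncate k x) n = of_real (cutoff (Suc k) n) * taylor_coeff x n"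
  by (auto simp: truncate_def coeff_sum if_distrib sum.delta cutoff_eq_0 cong: if_cong)

text \<open>Tannery's theorem, that is, dominated convergence for series: every term is eventually
  zero, and the majorant does not depend on k.\<close>

lemma tendsto_ip_dist_0:
  assumes u: "\<And>k. u k \<in> points H" and x: "x \<in> points H"
    and ev: "\<And>n. eventually (\<lambda>k. taylor_coeff (u k) n = taylor_coeff x n) sequentially"
    and bound: "\<And>k n. (cmod (taylor_coeff (u k) n - taylor_coeff x n))\<^sup>2 * wt n \<le> B n"
    and B: "summable B"
  shows "(\<lambda>k. ip_dist H (u k) x) \<longlonglongrightarrow> 0"
proof -
  let ?a = "\<lambda>n k. (cmod (taylor_coeff (u k) n - taylor_coeff x n))\<^sup>2 * wt n"
  have "(\<lambda>k. ?a n k) \<longlonglongrightarrow> 0" for n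
    by (rule tendsto_eventually) (use ev[of n] in \<open>auto elim!: eventually_mono\<close>)
  moreover have "eventually (\<lambda>(n, k). norm (?a n k) \<le> B n) (at_top \<times>\<^sub>F sequentially)"
    by (rule always_eventually) (use bound wt_pos in \<open>auto simp: abs_mult less_imp_le\<close>)
  ultimately have "(\<lambda>k. suminf (\<lambda>n. ?a n k)) \<longlonglongrightarrow> suminf (\<lambda>n. 0)"
    by (intro tannerys_theorem[THEN conjunct2, THEN conjunct2, OF _ _ B]) auto
  then have "(\<lambda>k. sqrt (suminf (\<lambda>n. ?a n k))) \<longlonglongrightarrow> sqrt 0"
    by (intro tendsto_real_sqrt) simp
  then show ?thesis
    unfolding ip_dist_fock(1)[OF u x] by simp
qed

lemma truncate_tendsto:
  assumes x: "x \<in> points H"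
  shows "(\<lambda>k. ip_dist H (poly (truncate k x)) x) \<longlonglongrightarrow> 0"
proof (rule tendsto_ip_dist_0[OF poly_in_points x])
  show "\<forall>\<^sub>F k in sequentially. taylor_coeff (poly (truncate k x)) n = taylor_coeff x n" for n
    using eventually_ge_at_top[of n]
    by eventually_elim (simp add: taylor_coeff_poly coeff_truncate cutoff_eq_1)
  show "summable (\<lambda>n. (cmod (taylor_coeff x n))\<^sup>2 * wt n)"
    using x by (simp add: in_points_iff)
  fix k n
  have "taylor_coeff (poly (truncate k x)) n - taylor_coeff x n
      = of_real (cutoff (Suc k) n - 1) * taylor_coeff x n"
    by (simp add: taylor_coeff_poly coeff_truncate algebra_simps)
  then have "(cmod (taylor_coeff (poly (truncate k x)) n - taylor_coeff x n))\<^sup>2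
      \<le> 1 * (cmod (taylor_coeff x n))\<^sup>2"
    using cutoff_bounds[of "Suc k" n]
    by (simp add: norm_mult power_mult_distrib abs_square_le_1 mult_left_le_one_le del: of_real_diff)
  then show "(cmod (taylor_coeff (poly (truncate k x)) n - taylor_coeff x n))\<^sup>2 * wt n
      \<le> (cmod (taylor_coeff x n))\<^sup>2 * wt n"
    using wt_pos[of n] by (intro mult_right_mono) auto
qed

text \<open>The cutoff is flat enough that its commutator with the operator is bounded uniformly in
  \<open>k\<close>, since the off-diagonal coefficients grow only linearly.\<close>

lemma jacobi_truncate_tendsto:
  assumes xy: "(x, y) \<in> max_op l c"
  shows "(\<lambda>k. ip_dist H (poly (jacobi_poly_op \<eta> \<sigma> l c (truncate k x))) y) \<longlonglongrightarrow> 0"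
proof -
  let ?C = "2 * \<sigma> + 4 * \<eta>" and ?J = "jacobi_coeff \<eta> \<sigma>"
  let ?sh = "\<lambda>g n. case n of 0 \<Rightarrow> (0::real) | Suc m \<Rightarrow> g m"
  define X where "X n = (cmod (taylor_coeff x n))\<^sup>2 * wt n" for n
  define Y where "Y n = (cmod (taylor_coeff y n))\<^sup>2 * wt n" for n
  have x: "x \<in> points H" and y: "y \<in> points H"
    and yn: "\<And>n. taylor_coeff y n = three_term \<eta> \<sigma> l c (taylor_coeff x) n"
    using xy by (auto simp: max_op_def)
  have sumX: "summable X" and sumY: "summable Y"
    using x y by (auto simp: X_def[abs_def] Y_def[abs_def] in_points_iff)
  show ?thesis
  proof (rule tendsto_ip_dist_0[OF poly_in_points y])
    show "\<forall>\<^sub>F k in sequentially.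
        taylor_coeff (poly (jacobi_poly_op \<eta> \<sigma> l c (truncate k x))) n = taylor_coeff y n" for n
      using eventually_ge_at_top[of n]
      by eventually_elim (simp add: taylor_coeff_poly coeff_jacobi_poly_op yn three_term_def
          coeff_truncate cutoff_eq_1 split: nat.split)
    \<comment> \<open>The factors 2, 4, 4 come from \<open>norm_add3_square_le\<close> and
      \<open>?C\<close> from \<open>cutoff_step\<close>.\<close>
    show "summable (\<lambda>n. 2 * Y n + 4 * ?C * ?sh X n + 4 * ?C * X (Suc n))"
      using sumX sumY summable_Suc_iff[of "?sh X"] summable_Suc_iff[of X]
      by (intro summable_add summable_mult) simp_all
    fix k n
    let ?\<chi> = "cutoff (Suc k)"
    \<comment> \<open>The error splits into the cutoff error of \<open>y\<close> itself, p, and the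
      two off-diagonal parts q and r of the commutator of cutoff and matrix. The diagonal commutes
      with the cutoff.\<close>
    define p where "p = of_real (?\<chi> n - 1) * taylor_coeff y n"
    define q where "q = (case n of 0 \<Rightarrow> 0 | Suc m \<Rightarrow> of_real (?\<chi> m - ?\<chi> (Suc m)) * taylor_coeff x m)"
    define r where "r = of_real (?J n * (?\<chi> (Suc n) - ?\<chi> n)) * taylor_coeff x (Suc n)"
    have "taylor_coeff (poly (jacobi_poly_op \<eta> \<sigma> l c (truncate k x))) n - taylor_coeff y n = p + q + r"
      by (cases n) (simp_all add: taylor_coeff_poly coeff_jacobi_poly_op three_term_def coeff_truncate
          p_def q_def r_def yn algebra_simps)
    moreover have "(cmod p)\<^sup>2 * wt n \<le> Y n"
    proof -
      have "(cmod p)\<^sup>2 \<le> 1 * (cmod (taylor_coeff y n))\<^sup>2"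
        using cutoff_bounds[of "Suc k" n] unfolding norm_mult power_mult_distrib p_def
        by (intro mult_right_mono) (auto simp: norm_mult abs_square_le_1 simp del: of_real_diff)
      then show ?thesis
        using wt_pos[of n] by (simp add: Y_def)
    qed
    moreover have "(cmod q)\<^sup>2 * wt n \<le> ?C * ?sh X n"
    proof (cases n)
      case (Suc m)
      have "(cmod q)\<^sup>2 * wt n = ((?\<chi> (Suc m) - ?\<chi> m)\<^sup>2 * ?J m) * X m"
        by (simp add: Suc q_def wt_Suc X_def norm_mult power_mult_distrib power2_commute
            mult_ac del: of_real_diff)
      also have "\<dots> \<le> ?C * X m"
        using wt_pos[of m] by (intro mult_right_mono cutoff_step) (auto simp: X_def)
      finally show ?thesis
        by (simp add: Suc)
    qed (simp add: q_def)
    moreover have "(cmod r)\<^sup>2 * wt n \<le> ?C * X (Suc n)"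
    proof -
      \<comment> \<open>One of the two factors \<open>?J n\<close> turns the weight at n into the
        weight at n + 1, where the coefficient of \<open>x\<close> sits; the other is paid for by
        the squared slope.\<close>
      have "(cmod r)\<^sup>2 * wt n = ((?\<chi> (Suc n) - ?\<chi> n)\<^sup>2 * ?J n) * X (Suc n)"
        by (simp add: r_def wt_Suc X_def norm_mult power_mult_distrib power2_eq_square[of "?J n"]
            mult_ac del: of_real_diff of_real_mult)
      also have "\<dots> \<le> ?C * X (Suc n)"
        using wt_pos[of "Suc n"] by (intro mult_right_mono cutoff_step) (auto simp: X_def)
      finally show ?thesis .
    qed
    moreover have "(cmod (p + q + r))\<^sup>2 * wt n
        \<le> (2 * (cmod p)\<^sup>2 + 4 * (cmod q)\<^sup>2 + 4 * (cmod r)\<^sup>2) * wt n"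
      using wt_pos[of n] by (intro mult_right_mono norm_add3_square_le) auto
    ultimately show "(cmod (taylor_coeff (poly (jacobi_poly_op \<eta> \<sigma> l c (truncate k x))) n
        - taylor_coeff y n))\<^sup>2 * wt n \<le> 2 * Y n + 4 * ?C * ?sh X n + 4 * ?C * X (Suc n)"
      by (simp add: distrib_right)
  qed
qed

text \<open>Truncations approximate every element of the maximal operator in the graph norm.
  Conversely the maximal operator is closed, because each of its equations involves finitely many
  coefficients and these depend continuously on the element.\<close>

lemma op_closure_R: "op_closure H (R l c) = max_op l c"
proof
  show "max_op l c \<subseteq> op_closure H (R l c)"
  proof
    fix z assume z: "z \<in> max_op l c"
    then obtain x y where xy: "z = (x, y)" "x \<in> points H" "y \<in> points H"
      by (auto simp: max_op_def)
    have "(\<forall>k. (poly (truncate k x), poly (jacobi_poly_op \<eta> \<sigma> l c (truncate k x))) \<in> R l c) \<and>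
        (\<lambda>k. ip_dist H (poly (truncate k x)) x) \<longlonglongrightarrow> 0 \<and>
        (\<lambda>k. ip_dist H (poly (jacobi_poly_op \<eta> \<sigma> l c (truncate k x))) y) \<longlonglongrightarrow> 0"
      using truncate_tendsto jacobi_truncate_tendsto z xy by (auto simp: poly_graph_def)
    then have "\<exists>u v. (\<forall>k. (u k, v k) \<in> R l c) \<and> (\<lambda>k. ip_dist H (u k) x) \<longlonglongrightarrow> 0 \<and>
        (\<lambda>k. ip_dist H (v k) y) \<longlonglongrightarrow> 0"
      by (intro exI)
    with xy show "z \<in> op_closure H (R l c)"
      by (simp add: op_closure_def)
  qed
  show "op_closure H (R l c) \<subseteq> max_op l c"
  proof
    fix z assume "z \<in> op_closure H (R l c)"
    then obtain x y u v where z: "z = (x, y)" and pts: "x \<in> points H" "y \<in> points H"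
      and uv: "\<And>k::nat. (u k, v k) \<in> R l c"
      and lim: "(\<lambda>k. ip_dist H (u k) x) \<longlonglongrightarrow> 0" "(\<lambda>k. ip_dist H (v k) y) \<longlonglongrightarrow> 0"
      unfolding op_closure_def by blast
    have uv': "u k \<in> points H" "v k \<in> points H"
      "taylor_coeff (v k) n = three_term \<eta> \<sigma> l c (taylor_coeff (u k)) n" for k n
      using uv[of k] R_subset_max_op[of l c] by (auto simp: max_op_def)
    have "taylor_coeff y n = three_term \<eta> \<sigma> l c (taylor_coeff x) n" for n
    proof (rule LIMSEQ_unique)
      show "(\<lambda>k. taylor_coeff (v k) n) \<longlonglongrightarrow> taylor_coeff y n"
        using uv'(2) pts(2) lim(2) by (rule tendsto_taylor_coeff)
      have "(\<lambda>k. taylor_coeff (u k) m) \<longlonglongrightarrow> taylor_coeff x m" for m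
        using uv'(1) pts(1) lim(1) by (rule tendsto_taylor_coeff)
      then show "(\<lambda>k. taylor_coeff (v k) n) \<longlonglongrightarrow> three_term \<eta> \<sigma> l c (taylor_coeff x) n"
        unfolding uv'(3) three_term_def by (cases n) (auto intro!: tendsto_intros)
    qed
    with z pts show "z \<in> max_op l c"
      by (simp add: max_op_def)
  qed
qed

lemma densely_defined_R: "densely_defined H (R l c)"
  unfolding densely_defined_def
proof (intro conjI ballI allI impI poly_graph_subset_points)
  fix x and e :: real assume "x \<in> points H" "e > 0"
  then obtain k where "ip_dist H (poly (truncate k x)) x < e"
    using order_tendstoD(2)[OF truncate_tendsto] eventually_happens sequentially_bot by blast
  moreover have "ip_dist H x (poly (truncate k x)) = ip_dist H (poly (truncate k x)) x"
    using \<open>x \<in> points H\<close> by (simp add: ip_dist_fock(1) poly_in_points norm_minus_commute)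
  ultimately show "\<exists>y\<in>Domain (R l c). ip_dist H x y < e"
    by (auto simp: poly_graph_def intro!: bexI[of _ "poly (truncate k x)"])
qed

lemma adjoint_max_op: "adjoint_op H (max_op l c) = max_op (cnj l) (cnj c)"
  using adjoint_op_closure[OF poly_graph_subset_points, of "jacobi_poly_op \<eta> \<sigma> l c"]
  by (simp add: op_closure_R adjoint_R)

lemma essentially_self_adjoint_R:
  assumes "l \<in> \<real>" "c \<in> \<real>"
  shows "essentially_self_adjoint H (R l c)"
proof -
  have "cnj l = l" "cnj c = c"
    using assms by (simp_all add: Reals_cnj_iff)
  moreover have "densely_defined H (max_op l c)"
    using densely_defined_R[of l c] R_subset_max_op[of l c]
    unfolding densely_defined_def by (auto simp: max_op_def; blast)
  ultimately show ?thesis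
    using densely_defined_R R_subset_max_op
    by (simp add: essentially_self_adjoint_def symmetric_op_def self_adjoint_op_def op_closure_R
        adjoint_R adjoint_max_op)
qed

text \<open>In the Meixner case this identifies the closure of \<rho>, shifted by \<sigma> /
  \<alpha>, with the maximal operator whose constant is 0.\<close>

lemma op_minus_scalar_max_op: "op_minus_scalar H (max_op l c) d = max_op l (c - d)"
proof (intro set_eqI iffI)
  fix z assume "z \<in> op_minus_scalar H (max_op l c) d"
  then obtain x y where "(x, y) \<in> max_op l c" "z = (x, add H y (scale H (- d) x))"
    by (auto simp: op_minus_scalar_def)
  then show "z \<in> max_op l (c - d)"
    by (auto simp: max_op_def points_add points_scale taylor_coeff_add taylor_coeff_scale
        three_term_def algebra_simps)
next
  fix z assume "z \<in> max_op l (c - d)"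
  then obtain x y where z: "(x, y) \<in> max_op l (c - d)" "z = (x, y)"
    by (cases z) auto
  then have "(x, add H y (scale H d x)) \<in> max_op l c"
    by (auto simp: max_op_def points_add points_scale taylor_coeff_add taylor_coeff_scale
        three_term_def algebra_simps)
  moreover have "y = add H (add H y (scale H d x)) (scale H (- d) x)"
    by (simp add: fock_def)
  ultimately show "z \<in> op_minus_scalar H (max_op l c) d"
    unfolding op_minus_scalar_def z(2) by blast
qed

end

section \<open>The intertwining relation\<close>

lemma jacobi_poly_op_add:
  "jacobi_poly_op \<eta> \<sigma> l c (p + q) = jacobi_poly_op \<eta> \<sigma> l c p + jacobi_poly_op \<eta> \<sigma> l c q"
  by (simp add: jacobi_poly_op_def opZ_def pderiv_add smult_add_right algebra_simps)

lemma jacobi_poly_op_smult: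
  "jacobi_poly_op \<eta> \<sigma> l c (smult a p) = smult a (jacobi_poly_op \<eta> \<sigma> l c p)"
  by (simp add: jacobi_poly_op_def opZ_def pderiv_smult smult_add_right mult_ac)

text \<open>These are the coefficients of the recurrence for \<open>s_poly\<close>, with z^n in the
  place of the n-th polynomial. At n = 0 the truncated index n - 1 is harmless, since its
  coefficient vanishes.\<close>

lemma jacobi_poly_op_monom:
  "jacobi_poly_op \<eta> \<sigma> l c (monom 1 n) = monom 1 (Suc n) + smult (l * of_nat n + c) (monom 1 n)
     + smult (of_real \<sigma> * of_nat n + of_real \<eta> * of_nat n * (of_nat n - 1)) (monom 1 (n - 1))"
proof -
  have Z: "opZ (monom a m) = monom a (Suc m)" for a m
    by (simp add: opZ_def monom_Suc)
  have "smult (of_real \<eta>) (opZ (opD (opD (monom 1 n))))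
      = smult (of_real \<eta> * of_nat n * (of_nat n - 1)) (monom 1 (n - 1))"
    unfolding pderiv_monom Z smult_monom by (cases n; cases "n - 1") (simp_all add: mult_ac)
  moreover have "smult l (opZ (opD (monom 1 n))) = smult (l * of_nat n) (monom 1 n)"
    unfolding pderiv_monom Z smult_monom by (cases n) simp_all
  moreover have "smult (of_real \<sigma>) (opD (monom 1 n))
      = smult (of_real \<sigma> * of_nat n) (monom 1 (n - 1))"
    by (simp add: pderiv_monom smult_monom)
  ultimately show ?thesis
    unfolding jacobi_poly_op_def by (simp only: Z smult_add_left add_ac)
qed

lemma poly_induct_monom [case_names add smult monom]:
  fixes P :: "complex poly \<Rightarrow> bool"
  assumes add: "\<And>p q. P p \<Longrightarrow> P q \<Longrightarrow> P (p + q)"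
    and smult: "\<And>a p. P p \<Longrightarrow> P (smult a p)"
    and monom: "\<And>n. P (monom 1 n)"
  shows "P p"
proof -
  have m: "P (monom a n)" for a n
    using smult[OF monom, of a n] by (simp add: smult_monom)
  have "P (\<Sum>i\<le>n. monom (coeff p i) i)" for n
    by (induction n) (use add m in auto)
  from this[of "degree p"] show ?thesis
    by (simp add: poly_as_sum_of_monoms)
qed

text \<open>For each p a polynomial q is sought whose class is sent to p while the class of x q is
  sent to the image of p. The condition is linear in the pair, so monomials suffice, and there the
  recurrence provides q = \<open>s_poly \<alpha> \<beta> \<sigma> n\<close>.\<close>

lemma poly_graph_subset_mult_by_var:
  assumes S: "unitary_op (L2 (mu \<alpha> \<beta> \<sigma>)) (fock (eta \<alpha> \<beta>) \<sigma>) S"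
    and s: "intertwines_s_poly \<alpha> \<beta> \<sigma> S"
    and sq: "\<And>p. (\<lambda>x. poly p (of_real x)) \<in> square_integrable (mu \<alpha> \<beta> \<sigma>)"
  shows "poly_graph (jacobi_poly_op (eta \<alpha> \<beta>) \<sigma> (\<alpha> + \<beta>) (ell \<alpha> \<beta> \<sigma>))
    \<subseteq> map_prod S S ` mult_by_var (mu \<alpha> \<beta> \<sigma>)"
proof -
  let ?M = "mu \<alpha> \<beta> \<sigma>" and ?J = "jacobi_poly_op (eta \<alpha> \<beta>) \<sigma> (\<alpha> + \<beta>) (ell \<alpha> \<beta> \<sigma>)"
  define cls where "cls p = ae_class ?M (\<lambda>x. poly p (of_real x))" for p :: "complex poly"
  have cls: "cls p \<in> points (L2 ?M)" for p
    unfolding cls_def by (rule ae_class_in_points[OF sq])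
  have S_add: "S (cls (p + q)) = (\<lambda>z. S (cls p) z + S (cls q) z)" for p q
  proof -
    have "cls (p + q) = add (L2 ?M) (cls p) (cls q)"
      unfolding cls_def using sq by (simp add: add_ae_class square_integrable_measurable)
    then show ?thesis
      using S cls by (simp add: unitary_op_def fock_def)
  qed
  have S_smult: "S (cls (smult a p)) = (\<lambda>z. a * S (cls p) z)" for a p
  proof -
    have "cls (smult a p) = scale (L2 ?M) a (cls p)"
      unfolding cls_def using sq by (simp add: scale_ae_class square_integrable_measurable)
    then show ?thesis
      using S cls by (simp add: unitary_op_def fock_def)
  qed
  have S_s: "S (cls (s_poly \<alpha> \<beta> \<sigma> n)) = poly (monom 1 n)" for n
    using s by (simp add: intertwines_s_poly_def cls_def poly_monom[abs_def])
  have "\<exists>q. S (cls q) = poly p \<and> S (cls ([:0, 1:] * q)) = poly (?J p)" for p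
  proof (induction p rule: poly_induct_monom)
    case (add p1 p2)
    then obtain q1 q2 where "S (cls q1) = poly p1" "S (cls ([:0, 1:] * q1)) = poly (?J p1)"
      "S (cls q2) = poly p2" "S (cls ([:0, 1:] * q2)) = poly (?J p2)"
      by blast
    then have "S (cls (q1 + q2)) = poly (p1 + p2)"
      "S (cls ([:0, 1:] * (q1 + q2))) = poly (?J (p1 + p2))"
      unfolding distrib_left jacobi_poly_op_add S_add by auto
    then show ?case
      by blast
  next
    case (smult a p)
    then obtain q where "S (cls q) = poly p" "S (cls ([:0, 1:] * q)) = poly (?J p)"
      by blast
    then have "S (cls (smult a q)) = poly (smult a p)"
      "S (cls ([:0, 1:] * (smult a q))) = poly (?J (smult a p))"
      unfolding mult_smult_right jacobi_poly_op_smult S_smult by auto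
    then show ?case
      by blast
  next
    case (monom n)
    have "[:0, 1:] * s_poly \<alpha> \<beta> \<sigma> n = s_poly \<alpha> \<beta> \<sigma> (Suc n)
       + smult ((\<alpha> + \<beta>) * of_nat n + ell \<alpha> \<beta> \<sigma>) (s_poly \<alpha> \<beta> \<sigma> n)
       + smult (of_real \<sigma> * of_nat n + of_real (eta \<alpha> \<beta>) * of_nat n * (of_nat n - 1))
           (s_poly \<alpha> \<beta> \<sigma> (n - 1))"
      by simp
    then have "S (cls ([:0, 1:] * s_poly \<alpha> \<beta> \<sigma> n)) = poly (?J (monom 1 n))"
      unfolding jacobi_poly_op_monom by (simp only: S_add S_smult S_s) auto
    with S_s show ?case
      by blast
  qed
  then have "\<exists>q. (poly p, poly (?J p)) = map_prod S S (cls q, cls ([:0, 1:] * q))" for p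
    by (metis map_prod_simp)
  moreover have "(cls q, cls ([:0, 1:] * q)) \<in> mult_by_var ?M" for q
    using sq[of q] sq[of "[:0, 1:] * q"] unfolding mult_by_var_def cls_def by auto
  ultimately show ?thesis
    unfolding poly_graph_def by (metis (no_types, lifting) image_eqI image_subsetI)
qed

section \<open>The three parameter cases together\<close>

lemma square_integrable_poly_mu:
  assumes "\<sigma> > 0" "gamma_case \<alpha> \<beta> \<or> negbin_case \<alpha> \<beta> \<or> meixner_case \<alpha> \<beta>"
  shows "(\<lambda>x. x) \<in> borel_measurable (mu \<alpha> \<beta> \<sigma>)"
    and "(\<lambda>x. poly p (of_real x)) \<in> square_integrable (mu \<alpha> \<beta> \<sigma>)"
proof -
  show id: "(\<lambda>x. x) \<in> borel_measurable (mu \<alpha> \<beta> \<sigma>)"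
    using assms gamma_moments(1) negbin_moments(1) meixner_moments(1) by blast
  have "integrable (mu \<alpha> \<beta> \<sigma>) (\<lambda>x. x ^ k)" for k
    using assms gamma_moments(2) negbin_moments(2) meixner_moments(2) by blast
  with id show "(\<lambda>x. poly p (of_real x)) \<in> square_integrable (mu \<alpha> \<beta> \<sigma>)"
    by (rule square_integrable_poly)
qed

lemma parameter_facts:
  assumes "gamma_case \<alpha> \<beta> \<or> negbin_case \<alpha> \<beta> \<or> meixner_case \<alpha> \<beta>"
  shows "\<alpha> \<noteq> 0" "\<alpha> * \<beta> = of_real (eta \<alpha> \<beta>)" "eta \<alpha> \<beta> > 0" "\<alpha> + \<beta> \<in> \<real>" "ell \<alpha> \<beta> \<sigma> \<in> \<real>"
proof -
  consider (real) "gamma_case \<alpha> \<beta> \<or> negbin_case \<alpha> \<beta>" | (complex) "meixner_case \<alpha> \<beta>"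
    using assms by blast
  then have "\<alpha> \<noteq> 0 \<and> \<alpha> * \<beta> = of_real (eta \<alpha> \<beta>) \<and> eta \<alpha> \<beta> > 0 \<and> \<alpha> + \<beta> \<in> \<real> \<and> ell \<alpha> \<beta> \<sigma> \<in> \<real>"
  proof cases
    case real
    then have re: "Im \<alpha> = 0" "Im \<beta> = 0" "Re \<alpha> > 0" "Re \<beta> > 0"
      by (auto simp: gamma_case_def negbin_case_def)
    then have "\<alpha> \<noteq> 0" "eta \<alpha> \<beta> > 0" "\<alpha> * \<beta> = of_real (eta \<alpha> \<beta>)"
      by (auto simp: eta_def complex_eq_iff)
    moreover have "\<alpha> + \<beta> \<in> \<real>" "\<alpha> \<in> \<real>"
      using re by (simp_all add: complex_is_Real_iff)
    moreover from this have "ell \<alpha> \<beta> \<sigma> \<in> \<real>"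
      by (simp add: ell_def Reals_divide)
    ultimately show ?thesis
      by blast
  next
    case complex
    then have im: "Im \<alpha> > 0" and \<beta>: "\<beta> = cnj \<alpha>"
      by (auto simp: meixner_case_def)
    then have "\<alpha> \<noteq> 0"
      by auto
    moreover have "eta \<alpha> \<beta> > 0"
      using im by (simp add: eta_def \<beta> add_nonneg_pos power2_eq_square[symmetric])
    moreover have "\<alpha> * \<beta> = of_real (eta \<alpha> \<beta>)" "\<alpha> + \<beta> \<in> \<real>"
      by (simp_all add: eta_def \<beta> complex_eq_iff complex_is_Real_iff)
    moreover have "ell \<alpha> \<beta> \<sigma> \<in> \<real>"
      using complex by (simp add: ell_def)
    ultimately show ?thesis
      by blast
  qed
  then show "\<alpha> \<noteq> 0" "\<alpha> * \<beta> = of_real (eta \<alpha> \<beta>)" "eta \<alpha> \<beta> > 0" "\<alpha> + \<beta> \<in> \<real>" "ell \<alpha> \<beta> \<sigma> \<in> \<real>"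
    by blast+
qed

theorem proposition3p6:
  fixes \<alpha> \<beta> :: complex and \<sigma> :: real
  assumes "\<sigma> > 0"
    and "gamma_case \<alpha> \<beta> \<or> negbin_case \<alpha> \<beta> \<or> meixner_case \<alpha> \<beta>"
  shows
    "(\<forall>p. rho \<alpha> \<beta> \<sigma> p =
        opZ p + smult (\<alpha> + \<beta>) (opZ (opD p)) + smult (of_real \<sigma> / \<alpha>) p
        + smult (of_real \<sigma>) (opD p) + smult (of_real (eta \<alpha> \<beta>)) (opZ (opD (opD p)))) \<and>
     (gamma_case \<alpha> \<beta> \<or> negbin_case \<alpha> \<beta> \<longrightarrow>
        essentially_self_adjoint (fock (eta \<alpha> \<beta>) \<sigma>) (poly_graph (rho \<alpha> \<beta> \<sigma>))) \<and>
     (meixner_case \<alpha> \<beta> \<longrightarrow>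
        essentially_self_adjoint (fock (eta \<alpha> \<beta>) \<sigma>)
          (poly_graph (\<lambda>p. rho \<alpha> \<beta> \<sigma> p - smult (of_real \<sigma> / \<alpha>) p))) \<and>
     (\<forall>S. unitary_op (L2 (mu \<alpha> \<beta> \<sigma>)) (fock (eta \<alpha> \<beta>) \<sigma>) S \<and> intertwines_s_poly \<alpha> \<beta> \<sigma> S \<longrightarrow>
        (gamma_case \<alpha> \<beta> \<or> negbin_case \<alpha> \<beta> \<longrightarrow>
           op_conj (L2 (mu \<alpha> \<beta> \<sigma>)) S (rho_closure \<alpha> \<beta> \<sigma>) = mult_by_var (mu \<alpha> \<beta> \<sigma>)) \<and>
        (meixner_case \<alpha> \<beta> \<longrightarrow>
           op_conj (L2 (mu \<alpha> \<beta> \<sigma>)) S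
             (op_minus_scalar (fock (eta \<alpha> \<beta>) \<sigma>) (rho_closure \<alpha> \<beta> \<sigma>) (of_real \<sigma> / \<alpha>))
           = mult_by_var (mu \<alpha> \<beta> \<sigma>)))"
proof -
  note \<alpha> = parameter_facts(1)[OF assms(2)] and \<eta> = parameter_facts(2)[OF assms(2)]
    and l = parameter_facts(4)[OF assms(2)] and c = parameter_facts(5)[OF assms(2), of \<sigma>]
  interpret fock_params "eta \<alpha> \<beta>" \<sigma>
    using parameter_facts(3)[OF assms(2)] assms(1) by unfold_locales
  have ell_real: "ell \<alpha> \<beta> \<sigma> = of_real \<sigma> / \<alpha>" if "gamma_case \<alpha> \<beta> \<or> negbin_case \<alpha> \<beta>"
  proof -
    have "\<not> meixner_case \<alpha> \<beta>"
      using that unfolding gamma_case_def negbin_case_def meixner_case_def by linarith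
    then show ?thesis
      by (simp add: ell_def)
  qed
  have ell_complex: "ell \<alpha> \<beta> \<sigma> = 0" if "meixner_case \<alpha> \<beta>"
    using that by (simp add: ell_def)
  have cnj_eq: "cnj (\<alpha> + \<beta>) = \<alpha> + \<beta>" "cnj (ell \<alpha> \<beta> \<sigma>) = ell \<alpha> \<beta> \<sigma>"
    using l c by (simp_all only: Reals_cnj_iff)
  have rho: "rho \<alpha> \<beta> \<sigma> = jacobi_poly_op (eta \<alpha> \<beta>) \<sigma> (\<alpha> + \<beta>) (of_real \<sigma> / \<alpha>)"
    by (rule ext) (rule rho_eq_jacobi_poly_op[OF \<alpha> \<eta>])
  have rho_shift: "(\<lambda>p. rho \<alpha> \<beta> \<sigma> p - smult (of_real \<sigma> / \<alpha>) p)
      = jacobi_poly_op (eta \<alpha> \<beta>) \<sigma> (\<alpha> + \<beta>) 0"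
    by (simp add: rho jacobi_poly_op_def fun_eq_iff)
  have closure: "rho_closure \<alpha> \<beta> \<sigma> = max_op (\<alpha> + \<beta>) (of_real \<sigma> / \<alpha>)"
    by (simp add: rho_closure_def rho op_closure_R)
  \<comment> \<open>With \<open>ell\<close> as the constant, this serves all three cases: it is
    \<sigma> / \<alpha> in the first two, and in the third it is the 0 that remains after the
    shift.\<close>
  have conj: "op_conj (L2 (mu \<alpha> \<beta> \<sigma>)) S (max_op (\<alpha> + \<beta>) (ell \<alpha> \<beta> \<sigma>)) = mult_by_var (mu \<alpha> \<beta> \<sigma>)"
    if "unitary_op (L2 (mu \<alpha> \<beta> \<sigma>)) H S" "intertwines_s_poly \<alpha> \<beta> \<sigma> S" for S
  proof (rule op_conj_adjoint_eq[OF that(1)])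
    show "adjoint_op (L2 (mu \<alpha> \<beta> \<sigma>)) (mult_by_var (mu \<alpha> \<beta> \<sigma>)) = mult_by_var (mu \<alpha> \<beta> \<sigma>)"
      by (rule adjoint_mult_by_var[OF square_integrable_poly_mu(1)[OF assms]])
    show "R (\<alpha> + \<beta>) (ell \<alpha> \<beta> \<sigma>) \<subseteq> map_prod S S ` mult_by_var (mu \<alpha> \<beta> \<sigma>)"
      by (rule poly_graph_subset_mult_by_var[OF that square_integrable_poly_mu(2)[OF assms]])
    show "adjoint_op H (R (\<alpha> + \<beta>) (ell \<alpha> \<beta> \<sigma>)) = max_op (\<alpha> + \<beta>) (ell \<alpha> \<beta> \<sigma>)"
      unfolding adjoint_R cnj_eq ..
    show "adjoint_op H (max_op (\<alpha> + \<beta>) (ell \<alpha> \<beta> \<sigma>)) = max_op (\<alpha> + \<beta>) (ell \<alpha> \<beta> \<sigma>)"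
      unfolding adjoint_max_op cnj_eq ..
  qed
  have esa: "essentially_self_adjoint H (R (\<alpha> + \<beta>) (ell \<alpha> \<beta> \<sigma>))"
    using l c by (rule essentially_self_adjoint_R)
  show ?thesis
  proof (intro conjI allI impI)
    show "rho \<alpha> \<beta> \<sigma> p = opZ p + smult (\<alpha> + \<beta>) (opZ (opD p)) + smult (of_real \<sigma> / \<alpha>) p
        + smult (of_real \<sigma>) (opD p) + smult (of_real (eta \<alpha> \<beta>)) (opZ (opD (opD p)))" for p
      by (simp add: rho jacobi_poly_op_def)
  next
    assume "gamma_case \<alpha> \<beta> \<or> negbin_case \<alpha> \<beta>"
    then show "essentially_self_adjoint H (poly_graph (rho \<alpha> \<beta> \<sigma>))"
      using esa by (simp add: rho ell_real)
  next
    assume "meixner_case \<alpha> \<beta>"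
    then show "essentially_self_adjoint H (poly_graph (\<lambda>p. rho \<alpha> \<beta> \<sigma> p - smult (of_real \<sigma> / \<alpha>) p))"
      using esa by (simp add: rho_shift ell_complex)
  next
    fix S
    assume "unitary_op (L2 (mu \<alpha> \<beta> \<sigma>)) H S \<and> intertwines_s_poly \<alpha> \<beta> \<sigma> S"
      and "gamma_case \<alpha> \<beta> \<or> negbin_case \<alpha> \<beta>"
    then show "op_conj (L2 (mu \<alpha> \<beta> \<sigma>)) S (rho_closure \<alpha> \<beta> \<sigma>) = mult_by_var (mu \<alpha> \<beta> \<sigma>)"
      using conj by (simp add: closure ell_real)
  next
    fix S
    assume "unitary_op (L2 (mu \<alpha> \<beta> \<sigma>)) H S \<and> intertwines_s_poly \<alpha> \<beta> \<sigma> S"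
      and "meixner_case \<alpha> \<beta>"
    then show "op_conj (L2 (mu \<alpha> \<beta> \<sigma>)) S
        (op_minus_scalar H (rho_closure \<alpha> \<beta> \<sigma>) (of_real \<sigma> / \<alpha>)) = mult_by_var (mu \<alpha> \<beta> \<sigma>)"
      using conj by (simp add: closure op_minus_scalar_max_op ell_complex)
  qed
qed

end
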